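(* Let $E\subset\mathbb{R}^2$ be a closed, nondegenerate, convex quadrilateral and let $r\ge2$. The direct serendipity element with mapped supplements, $$\mathcal{DS}_r^{\mathrm{map}}(E)=\mathbb{P}_r(E)\oplus\mathrm{span}\big\{F_E^0\big((1-\hat x_2^2)\hat x_1\hat x_2^{r-2}\big),\ F_E^0\big((1-\hat x_1^2)\hat x_2\hat x_1^{r-2}\big)\big\},$$ is a well defined finite element: the sum is direct, $\dim\mathcal{DS}_r^{\mathrm{map}}(E)=D_r=\dim\mathbb{P}_r(E)+2$, and if $\phi\in\mathcal{DS}_r^{\mathrm{map}}(E)$ vanishes at all $D_r$ nodal points (defined in the context), then $\phi=0$.
   Context: $\mathbb{P}_k(E)$ is the space of polynomials of total degree at most $k$ restricted to $E$. $E$ is nondegenerate if it does not degenerate to a triangle, segment or point. $\hat E=[-1,1]^2$ with coordinates $\hat{\mathbf{x}}=(\hat x_1,\hat x_2)$, and $\mathbf{F}_E:\hat E\to E$ is the bilinear bijective map taking the vertices of $\hat E$ to the vertices of $E$ (consecutive vertices to consecutive vertices). For a function $\hat\phi$ on $\hat E$, $F_E^0(\hat\phi)$ is the function on $E$ given by $F_E^0(\hat\phi)(\mathbf{x})=\hat\phi(\hat{\mathbf{x}})$ with $\mathbf{x}=\mathbf{F}_E(\hat{\mathbf{x}})$. Nodal points. The $D_r=4+4(r-1)+\tfrac12(r-2)(r-3)=\tfrac12(r+2)(r+1)+2$ nodal points are: the 4 vertices of $E$; on each edge, $r-1$ interior points which together with the two end vertices are equally spaced; and, if $r\ge4$, $\tfrac12(r-2)(r-3)$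 interior points, namely the nodes of the Lagrange finite element of order $r-4$ on a (nondegenerate) triangle $T$ lying strictly inside $E$ (a single point if $r=4$). *)

theory Defs
  imports "HOL-Analysis.Analysis" "HOL-Library.Function_Algebras"
begin

text \<open>A function on a set \<open>E\<close> is represented by its extension by zero, so that the functions on
  \<open>E\<close> form a linear subspace of the space of all functions and equality means equality on \<open>E\<close>.\<close>

definition on_set :: "'a set \<Rightarrow> ('a \<Rightarrow> real) \<Rightarrow> 'a \<Rightarrow> real" where
  "on_set E f = (\<lambda>x. if x \<in> E then f x else 0)"

definition fun_scale :: "real \<Rightarrow> ('a \<Rightarrow> real) \<Rightarrow> 'a \<Rightarrow> real" where
  "fun_scale c f = (\<lambda>x. c * f x)"

interpretation fun_space: vector_space "fun_scale :: real \<Rightarrow> ('a \<Rightarrow> real) \<Rightarrow> 'a \<Rightarrow> real"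
  by unfold_locales (auto simp: fun_scale_def fun_eq_iff algebra_simps)

text \<open>A polytope is compact and convex; in the plane, having four extreme points excludes triangles,
  segments and points.\<close>

definition convex_quadrilateral :: "(real^2) set \<Rightarrow> bool" where
  "convex_quadrilateral E \<longleftrightarrow> polytope E \<and> card {x. x extreme_point_of E} = 4"

definition vertex_cycle :: "(real^2) set \<Rightarrow> (nat \<Rightarrow> real^2) \<Rightarrow> bool" where
  "vertex_cycle E v \<longleftrightarrow> bij_betw v {..<4} {x. x extreme_point_of E} \<and>
     (\<forall>i<4. closed_segment (v i) (v (Suc i mod 4)) edge_of E)"

definition ref_square :: "(real^2) set" where
  "ref_square = {x. \<forall>i. \<bar>x $ i\<bar> \<le> 1}"

text \<open>The map \<open>F\<^sub>E\<close>: the unique bilinear map that takes the vertices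
  \<open>(-1,-1), (1,-1), (1,1), (-1,1)\<close> to \<open>v 0, v 1, v 2, v 3\<close>.\<close>

definition bilinear_map :: "(nat \<Rightarrow> real^2) \<Rightarrow> real^2 \<Rightarrow> real^2" where
  "bilinear_map v x =
     ((1 - x$1) * (1 - x$2) / 4) *\<^sub>R v 0 + ((1 + x$1) * (1 - x$2) / 4) *\<^sub>R v 1 +
     ((1 + x$1) * (1 + x$2) / 4) *\<^sub>R v 2 + ((1 - x$1) * (1 + x$2) / 4) *\<^sub>R v 3"

definition push_forward :: "(real^2) set \<Rightarrow> (nat \<Rightarrow> real^2) \<Rightarrow> (real^2 \<Rightarrow> real) \<Rightarrow> real^2 \<Rightarrow> real" where
  "push_forward E v f = on_set E (\<lambda>x. f (inv_into ref_square (bilinear_map v) x))"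

definition poly_space :: "nat \<Rightarrow> (real^2) set \<Rightarrow> (real^2 \<Rightarrow> real) set" where
  "poly_space k E =
     {on_set E (\<lambda>x. \<Sum>i\<le>k. \<Sum>j\<le>k - i. c i j * (x$1)^i * (x$2)^j) | c :: nat \<Rightarrow> nat \<Rightarrow> real. True}"

definition supplements :: "nat \<Rightarrow> (real^2) set \<Rightarrow> (nat \<Rightarrow> real^2) \<Rightarrow> (real^2 \<Rightarrow> real) set" where
  "supplements r E v =
     {push_forward E v (\<lambda>x. (1 - (x$2)^2) * x$1 * (x$2)^(r - 2)),
      push_forward E v (\<lambda>x. (1 - (x$1)^2) * x$2 * (x$1)^(r - 2))}"

definition DS_map :: "nat \<Rightarrow> (real^2) set \<Rightarrow> (nat \<Rightarrow> real^2) \<Rightarrow> (real^2 \<Rightarrow> real) set" where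
  "DS_map r E v = {p + s | p s. p \<in> poly_space r E \<and> s \<in> fun_space.span (supplements r E v)}"

text \<open>For \<open>r = 2\<close> the truncated \<open>r - 3\<close> is multiplied by \<open>r - 2 = 0\<close>, so the formula is exact for all
  \<open>r \<ge> 2\<close>.\<close>

definition node_count :: "nat \<Rightarrow> nat" where
  "node_count r = 4 + 4 * (r - 1) + (r - 2) * (r - 3) div 2"

text \<open>The order 0 element has a single node, which we take to be the centroid of the triangle.\<close>

definition lagrange_nodes :: "nat \<Rightarrow> real^2 \<Rightarrow> real^2 \<Rightarrow> real^2 \<Rightarrow> (real^2) set" where
  "lagrange_nodes m a b c =
     (if m = 0 then {(1/3) *\<^sub>R (a + b + c)}
      else {(real i / real m) *\<^sub>R a + (real j / real m) *\<^sub>R b + (real k / real m) *\<^sub>R c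
            | i j k. i + j + k = m})"

definition edge_nodes :: "nat \<Rightarrow> real^2 \<Rightarrow> real^2 \<Rightarrow> (real^2) set" where
  "edge_nodes r a b =
     (\<lambda>j. (1 - real j / real r) *\<^sub>R a + (real j / real r) *\<^sub>R b) ` {1..r - 1}"

definition nodal_points ::
    "nat \<Rightarrow> (nat \<Rightarrow> real^2) \<Rightarrow> real^2 \<Rightarrow> real^2 \<Rightarrow> real^2 \<Rightarrow> (real^2) set" where
  "nodal_points r v a b c =
     v ` {..<4} \<union> (\<Union>i<4. edge_nodes r (v i) (v (Suc i mod 4))) \<union>
     (if 4 \<le> r then lagrange_nodes (r - 4) a b c else {})"

end

theory Submission
  imports Defs "HOL-Computational_Algebra.Polynomial"
begin

text \<open>
  Write a member of the space as \<open>\<phi> = p + c \<sigma>\<^sub>1 + d \<sigma>\<^sub>2\<close>, where \<open>p\<close> is a polynomial of degree at most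
  \<open>r\<close> and \<open>\<sigma>\<^sub>1, \<sigma>\<^sub>2\<close> are the two supplements. Everything rests on showing that \<open>c = d = 0\<close> as soon
  as \<open>\<phi>\<close> vanishes at the nodes on the boundary. The bilinear map is affine on each side of the
  reference square, so \<open>\<phi>\<close> is a polynomial of degree at most \<open>r\<close> along each edge; it has \<open>r + 1\<close>
  zeros there and vanishes on the edge. Now \<open>\<sigma>\<^sub>1\<close> vanishes on the sides \<open>x\<^sub>2 = \<plusminus>1\<close> and equals
  \<open>\<plusminus>w(t)\<close> with \<open>w(t) = (1 - t\<^sup>2) t\<^bsup>r - 2\<^esup>\<close> on the sides \<open>x\<^sub>1 = \<plusminus>1\<close>. Hence \<open>p\<close> is \<open>c w(s)\<close> on one
  edge and \<open>- c w(t)\<close> on the opposite one, and as \<open>p\<close> is a polynomial on the plane, this persists on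
  the two full lines.

  If the lines meet, then, by convexity, the common point lies beyond both edges in the same direction:
  its parameters \<open>s, t\<close> are both greater than 1 or both less than -1. Then \<open>w(s)\<close> and \<open>w(t)\<close> are
  nonzero of equal sign, while \<open>c w(s) = - c w(t)\<close>, so \<open>c = 0\<close>. If the lines are parallel, the
  leading coefficients of \<open>p\<close> along them differ by a positive factor, but are \<open>- c\<close> and \<open>c\<close>; again
  \<open>c = 0\<close>. This is lemma \<open>opposite_edges\<close>; the same lemma, used for the other two edges, gives
  \<open>d = 0\<close>.

  What is left is a polynomial \<open>p\<close> that vanishes on the four edge lines. It is the product of the four
  affine functions of the edges and a polynomial \<open>q\<close> of degree at most \<open>r - 4\<close>, which is zero for
  \<open>r < 4\<close> (\<open>deg_less_factor_lines\<close>). The edge functions are positive in the interior, so for \<open>r \<ge> 4\<close> it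
  vanishes at the nodes of the Lagrange element of order \<open>r - 4\<close> and is zero (\<open>lagrange_nodes_unisolvent\<close>).
  Directness of the sum and the dimension follow from \<open>c = d = 0\<close> and from the fact that a polynomial
  that vanishes on the quadrilateral has zero coefficients.

  The geometry of the quadrilateral enters through the supporting functionals \<open>\<beta>\<^sub>i - n\<^sub>i \<bullet> x\<close> of its
  edges: they exist since every face of a polytope is exposed, they vanish at the ends of their edge
  and are positive at the other two vertices.
\<close>

section \<open>Bivariate polynomial functions\<close>

text \<open>These are the polynomial functions of degree less than \<open>n\<close>. With the strict bound, \<open>n = 0\<close> leaves
  only the zero function, so that splitting off a linear factor is the truncated step from \<open>n\<close> to
  \<open>n - 1\<close> for every \<open>n\<close>, and low degrees are no special cases.\<close>

inductive deg_less :: "nat \<Rightarrow> (real^2 \<Rightarrow> real) \<Rightarrow> bool" where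
  zero: "deg_less n (\<lambda>x. 0)"
| const: "deg_less (Suc n) (\<lambda>x. c)"
| add: "deg_less n p \<Longrightarrow> deg_less n q \<Longrightarrow> deg_less n (\<lambda>x. p x + q x)"
| coord: "deg_less n p \<Longrightarrow> deg_less (Suc n) (\<lambda>x. x$i * p x)"

lemma deg_less_0_imp_zero: "deg_less 0 p \<Longrightarrow> p x = 0"
  by (induction "0::nat" p rule: deg_less.induct) auto

lemma deg_less_Suc: "deg_less n p \<Longrightarrow> deg_less (Suc n) p"
  by (induction rule: deg_less.induct) (auto intro: deg_less.intros)

lemma deg_less_scale: "deg_less n p \<Longrightarrow> deg_less n (\<lambda>x. c * p x)"
proof (induction rule: deg_less.induct)
  case (add n p q)
  then show ?case using deg_less.add[OF add.IH] by (simp add: algebra_simps)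
next
  case (coord n p i)
  then show ?case using deg_less.coord[OF coord.IH, of i] by (simp add: mult.left_commute)
qed (auto intro: deg_less.intros)

lemma deg_less_sum:
  "finite A \<Longrightarrow> (\<And>i. i \<in> A \<Longrightarrow> deg_less n (f i)) \<Longrightarrow> deg_less n (\<lambda>x. \<Sum>i\<in>A. f i x)"
  by (induction A rule: finite_induct) (auto intro: deg_less.intros)

lemma deg_less_mono: "deg_less m p \<Longrightarrow> m \<le> n \<Longrightarrow> deg_less n p"
  by (induction n) (auto simp: le_Suc_eq intro: deg_less_Suc)

lemma deg_less_monomial: "deg_less (Suc (i + j)) (\<lambda>x. (x$1)^i * (x$2)^j)"
proof (induction i)
  case 0
  show ?case
  proof (induction j)
    case 0
    show ?case using deg_less.const[of 0 1] by simp
  next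
    case (Suc j)
    then show ?case using deg_less.coord[OF Suc, of 2] by simp
  qed
next
  case (Suc i)
  then show ?case using deg_less.coord[OF Suc, of 1] by (simp add: mult.assoc)
qed

lemma deg_less_monomial_sum:
  "deg_less (Suc k) (\<lambda>x. \<Sum>i\<le>k. \<Sum>j\<le>k - i. c i j * (x$1)^i * (x$2)^j)"
proof (intro deg_less_sum finite_atMost)
  fix i j assume "i \<in> {..k}" "j \<in> {..k - i}"
  then have "deg_less (Suc k) (\<lambda>x. (x$1)^i * (x$2)^j)"
    by (intro deg_less_mono[OF deg_less_monomial]) auto
  then show "deg_less (Suc k) (\<lambda>x. c i j * (x$1)^i * (x$2)^j)"
    using deg_less_scale[of "Suc k" _ "c i j"] by (simp add: mult.assoc)
qed

text \<open>On the line through \<open>y\<close> with direction \<open>u\<close>, the top coefficient of a polynomial is the value at \<open>u\<close> of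
  its homogeneous part \<open>h\<close>. It depends on the direction only, which makes restrictions to parallel
  lines comparable.\<close>

lemma deg_less_leading_form:
  assumes "deg_less n p"
  obtains h where "\<And>s u. h (s *\<^sub>R u) = s ^ (n - 1) * h u"
    and "\<And>y u. \<exists>q. (\<forall>m\<ge>n. coeff q m = 0) \<and> (\<forall>t. poly q t = p (y + t *\<^sub>R u)) \<and> coeff q (n - 1) = h u"
proof -
  from assms have "\<exists>h. (\<forall>s u. h (s *\<^sub>R u) = s ^ (n - 1) * h u) \<and>
     (\<forall>y u. \<exists>q. (\<forall>m\<ge>n. coeff q m = 0) \<and> (\<forall>t. poly q t = p (y + t *\<^sub>R u)) \<and> coeff q (n - 1) = h u)"
  proof (induction rule: deg_less.induct)
    case (zero n)
    show ?case by (intro exI[of _ "\<lambda>u. 0"] conjI allI exI[of _ 0]) auto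
  next
    case (const n c)
    show ?case
      by (intro exI[of _ "\<lambda>u. if n = 0 then c else 0"] conjI allI exI[of _ "[:c:]"])
         (auto simp: coeff_pCons split: nat.split)
  next
    case (add n p q)
    then obtain h g where hom: "\<forall>s u. h (s *\<^sub>R u) = s ^ (n - 1) * h u" "\<forall>s u. g (s *\<^sub>R u) = s ^ (n - 1) * g u"
      and h: "\<forall>y u. \<exists>P. (\<forall>m\<ge>n. coeff P m = 0) \<and> (\<forall>t. poly P t = p (y + t *\<^sub>R u)) \<and> coeff P (n - 1) = h u"
      and g: "\<forall>y u. \<exists>P. (\<forall>m\<ge>n. coeff P m = 0) \<and> (\<forall>t. poly P t = q (y + t *\<^sub>R u)) \<and> coeff P (n - 1) = g u"
      by blast
    show ?case
    proof (intro exI[of _ "\<lambda>u. h u + g u"] conjI allI)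
      fix y u
      obtain P Q where "\<forall>m\<ge>n. coeff P m = 0" "\<forall>t. poly P t = p (y + t *\<^sub>R u)" "coeff P (n - 1) = h u"
        "\<forall>m\<ge>n. coeff Q m = 0" "\<forall>t. poly Q t = q (y + t *\<^sub>R u)" "coeff Q (n - 1) = g u"
        using h g by meson
      then show "\<exists>P. (\<forall>m\<ge>n. coeff P m = 0) \<and> (\<forall>t. poly P t = p (y + t *\<^sub>R u) + q (y + t *\<^sub>R u)) \<and>
          coeff P (n - 1) = h u + g u"
        by (intro exI[of _ "P + Q"]) auto
    qed (use hom in \<open>auto simp: algebra_simps\<close>)
  next
    case (coord n p i)
    then obtain h where hom: "\<forall>s u. h (s *\<^sub>R u) = s ^ (n - 1) * h u"
      and h: "\<forall>y u. \<exists>P. (\<forall>m\<ge>n. coeff P m = 0) \<and> (\<forall>t. poly P t = p (y + t *\<^sub>R u)) \<and> coeff P (n - 1) = h u"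
      by blast
    show ?case
    proof (intro exI[of _ "\<lambda>u. if n = 0 then 0 else u$i * h u"] conjI allI)
      fix y u :: "real^2"
      obtain P where P: "\<forall>m\<ge>n. coeff P m = 0" "\<forall>t. poly P t = p (y + t *\<^sub>R u)" "coeff P (n - 1) = h u"
        using h by meson
      then show "\<exists>P. (\<forall>m\<ge>Suc n. coeff P m = 0) \<and> (\<forall>t. poly P t = (y + t *\<^sub>R u)$i * p (y + t *\<^sub>R u)) \<and>
          coeff P (Suc n - 1) = (if n = 0 then 0 else u$i * h u)"
        by (intro exI[of _ "[:y$i, u$i:] * P"])
           (auto simp: coeff_pCons algebra_simps split: nat.splits)
    next
      fix s u
      show "(if n = 0 then 0 else (s *\<^sub>R u)$i * h (s *\<^sub>R u)) = s ^ (Suc n - 1) * (if n = 0 then 0 else u$i * h u)"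
        using hom by (cases n) (auto simp: algebra_simps)
    qed
  qed
  then show ?thesis using that by blast
qed

lemma poly_eq_0_if_many_zeros:
  fixes q :: "real poly"
  assumes "\<And>m. n \<le> m \<Longrightarrow> coeff q m = 0" and "finite Z" "n \<le> card Z" "\<And>z. z \<in> Z \<Longrightarrow> poly q z = 0"
  shows "q = 0"
proof (rule ccontr)
  assume q: "q \<noteq> 0"
  then have "degree q < n" using assms(1)[of "degree q"] by (metis leading_coeff_0_iff linorder_not_less)
  moreover have "card Z \<le> card {z. poly q z = 0}"
    using assms(4) by (intro card_mono poly_roots_finite q) auto
  moreover have "card {z. poly q z = 0} \<le> degree q" by (rule card_poly_roots_bound[OF q])
  ultimately show False using assms(3) by linarith
qed

lemma inner_two_coords:
  fixes a x :: "real^2" and i j :: 2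
  assumes "i \<noteq> j"
  shows "a \<bullet> x = a$i * x$i + a$j * x$j"
proof -
  have U: "(UNIV :: 2 set) = {i, j}"
    using assms by (metis (full_types) UNIV_2 exhaust_2 insert_commute)
  show ?thesis using assms unfolding inner_vec_def U by simp
qed

text \<open>Division with remainder by an affine function: on its zero line the coordinate \<open>x$i\<close> is an
  affine function of the other one, \<open>x$j\<close>, so the remainder is a polynomial in \<open>x$j\<close>.\<close>

lemma deg_less_divide:
  fixes a :: "real^2"
  assumes "deg_less n p" and "a$i \<noteq> 0" and "\<And>k. k = i \<or> k = j" and "i \<noteq> j"
  obtains q g where "deg_less (n - 1) q" "\<And>x. p x = (b - a \<bullet> x) * q x + poly g (x$j)"
proof -
  note inner = inner_two_coords[OF assms(4), of a]
  have step: "deg_less n (\<lambda>x. x$k * q x)" if "deg_less (n - 1) q" for n k q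
    using that by (cases n) (auto simp: deg_less_0_imp_zero intro: deg_less.intros)
  \<comment> \<open>The induction also bounds the degree of the remainder, which enters the quotient when \<open>p\<close> is multiplied by \<open>x$i\<close>.\<close>
  from assms(1) have "\<exists>q g. deg_less (n - 1) q \<and> deg_less n (\<lambda>x. poly g (x$j)) \<and>
     (\<forall>x. p x = (b - a \<bullet> x) * q x + poly g (x$j))"
  proof (induction rule: deg_less.induct)
    case (zero n)
    show ?case by (intro exI[of _ "\<lambda>x. 0"] exI[of _ 0]) (auto intro: deg_less.intros)
  next
    case (const n c)
    show ?case by (intro exI[of _ "\<lambda>x. 0"] exI[of _ "[:c:]"]) (auto intro: deg_less.intros)
  next
    case (add n p p')
    then obtain q g q' g' where "deg_less (n - 1) q" "deg_less n (\<lambda>x. poly g (x$j))" "\<forall>x. p x = (b - a \<bullet> x) * q x + poly g (x$j)"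
      "deg_less (n - 1) q'" "deg_less n (\<lambda>x. poly g' (x$j))" "\<forall>x. p' x = (b - a \<bullet> x) * q' x + poly g' (x$j)"
      by blast
    then show ?case
      by (intro exI[of _ "\<lambda>x. q x + q' x"] exI[of _ "g + g'"])
         (auto intro: deg_less.intros simp: distrib_left)
  next
    case (coord n p k)
    then obtain q g where q: "deg_less (n - 1) q" and g: "deg_less n (\<lambda>x. poly g (x$j))"
      and p: "\<forall>x. p x = (b - a \<bullet> x) * q x + poly g (x$j)"
      by blast
    consider "k = j" | "k = i" using assms(3) by blast
    then show ?case
    proof cases
      case 1
      then show ?thesis using step[OF q, of j] deg_less.coord[OF g, of j] p
        by (intro exI[of _ "\<lambda>x. x$j * q x"] exI[of _ "pCons 0 g"])
           (simp add: distrib_left mult.left_commute)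
    next
      case 2
      \<comment> \<open>Replace the factor \<open>x$i\<close> of the remainder by \<open>(b - a$j * x$j) / a$i - (b - a \<bullet> x) / a$i\<close>.\<close>
      have "deg_less n (\<lambda>x. x$i * q x + (- 1 / a$i) * poly g (x$j))"
        by (intro deg_less.add step q deg_less_scale g)
      moreover have "deg_less (Suc n) (\<lambda>x. (b / a$i) * poly g (x$j) + (- a$j / a$i) * (x$j * poly g (x$j)))"
        by (intro deg_less.add deg_less_scale deg_less_Suc deg_less.coord g)
      moreover have "x$i * p x = (b - a \<bullet> x) * (x$i * q x + (- 1 / a$i) * poly g (x$j)) +
          poly ([:b / a$i, - a$j / a$i:] * g) (x$j)" for x
        unfolding spec[OF p, of x] inner using assms(2) by (simp add: field_simps)
      ultimately show ?thesis using 2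
        by (intro exI[of _ "\<lambda>x. x$i * q x + (- 1 / a$i) * poly g (x$j)"] exI[of _ "[:b / a$i, - a$j / a$i:] * g"])
           (simp add: algebra_simps)
    qed
  qed
  then show ?thesis using that by blast
qed

text \<open>The remainder of the division is determined by its values on the line, as \<open>x$j\<close> takes every value there.\<close>

lemma deg_less_factor:
  fixes a :: "real^2"
  assumes p: "deg_less n p" and a: "a \<noteq> 0" and zero: "\<And>x. a \<bullet> x = b \<Longrightarrow> p x = 0"
  obtains q where "deg_less (n - 1) q" "\<And>x. p x = (b - a \<bullet> x) * q x"
proof -
  obtain i where i: "a$i \<noteq> 0" using a by (auto simp: vec_eq_iff)
  obtain j :: 2 where j: "i \<noteq> j" "\<And>k. k = i \<or> k = j"
    by (metis exhaust_2 zero_neq_one)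
  obtain q g where q: "deg_less (n - 1) q" and pq: "\<And>x. p x = (b - a \<bullet> x) * q x + poly g (x$j)"
    using deg_less_divide[OF p i j(2,1)] by metis
  have "poly g t = 0" for t
  proof -
    define x where "x = (\<chi> k. if k = j then t else (b - a$j * t) / a$i)"
    have "a \<bullet> x = b" using i j(1) by (simp add: inner_two_coords[OF j(1)] x_def)
    then show ?thesis using zero[of x] pq[of x] by (simp add: x_def)
  qed
  then show ?thesis using that[OF q] pq by simp
qed

lemma orthogonal_parallel:
  fixes a d y :: "real^2"
  assumes "a \<noteq> 0" "d \<noteq> 0" "a \<bullet> d = 0" "a \<bullet> y = 0"
  obtains t where "y = t *\<^sub>R d"
proof -
  have n: "a$1 * d$1 + a$2 * d$2 = 0" "a$1 * y$1 + a$2 * y$2 = 0"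
    using assms(3,4) by (simp_all add: inner_two_coords[of 1 2])
  have det: "d$1 * y$2 = d$2 * y$1"
  proof -
    have "a$1 * (d$1 * y$2 - d$2 * y$1) = 0" "a$2 * (d$1 * y$2 - d$2 * y$1) = 0"
      using n by algebra+
    moreover have "a$1 \<noteq> 0 \<or> a$2 \<noteq> 0" using assms(1) by (auto simp: vec_eq_iff forall_2)
    ultimately show ?thesis by auto
  qed
  consider "d$1 \<noteq> 0" | "d$2 \<noteq> 0" using assms(2) by (auto simp: vec_eq_iff forall_2)
  then show ?thesis
  proof cases
    case 1
    then have "y = (y$1 / d$1) *\<^sub>R d" using det by (simp add: vec_eq_iff forall_2 field_simps)
    then show ?thesis by (rule that)
  next
    case 2
    then have "y = (y$2 / d$2) *\<^sub>R d" using det by (simp add: vec_eq_iff forall_2 field_simps)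
    then show ?thesis by (rule that)
  qed
qed

lemma orthogonal_direction:
  fixes a :: "real^2"
  assumes "a \<noteq> 0"
  obtains u where "u \<noteq> 0" "a \<bullet> u = 0"
proof
  show "vector [- a$2, a$1] \<noteq> (0 :: real^2)"
    using assms by (auto simp: vec_eq_iff forall_2)
  show "a \<bullet> vector [- a$2, a$1] = 0"
    by (simp add: inner_two_coords[of 1 2])
qed

text \<open>After the first lines are split off, the cofactor still vanishes on the next line: restricted to this
  line, each earlier factor is a nonzero univariate polynomial, and these have no zero divisors.\<close>

lemma deg_less_factor_lines:
  fixes a :: "nat \<Rightarrow> real^2"
  assumes "deg_less n p" and "\<And>i. i < m \<Longrightarrow> a i \<noteq> 0"
    and "\<And>i j. i < j \<Longrightarrow> j < m \<Longrightarrow> \<exists>y. a j \<bullet> y = b j \<and> a i \<bullet> y \<noteq> b i"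
    and "\<And>i x. i < m \<Longrightarrow> a i \<bullet> x = b i \<Longrightarrow> p x = 0"
  shows "\<exists>q. deg_less (n - m) q \<and> (\<forall>x. p x = (\<Prod>i<m. b i - a i \<bullet> x) * q x)"
  using assms(2-4)
proof (induction m)
  case 0
  then show ?case using assms(1) by auto
next
  case (Suc m)
  have "\<exists>q. deg_less (n - m) q \<and> (\<forall>x. p x = (\<Prod>i<m. b i - a i \<bullet> x) * q x)"
    by (rule Suc.IH; meson Suc.prems less_SucI)
  then obtain q where q: "deg_less (n - m) q" and pq: "\<And>x. p x = (\<Prod>i<m. b i - a i \<bullet> x) * q x"
    by blast
  have am: "a m \<noteq> 0" using Suc.prems by simp
  have "q x = 0" if x: "a m \<bullet> x = b m" for x
  proof -
    obtain u where u: "u \<noteq> 0" "a m \<bullet> u = 0" using orthogonal_direction[OF am] by blast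
    obtain Q where Q: "\<And>t. poly Q t = q (x + t *\<^sub>R u)"
      using deg_less_leading_form[OF q] by metis
    define L where "L i = [:b i - a i \<bullet> x, - (a i \<bullet> u):]" for i
    have L: "poly (L i) t = b i - a i \<bullet> (x + t *\<^sub>R u)" for i t
      by (simp add: L_def inner_simps)
    have "L i \<noteq> 0" if i: "i < m" for i
    proof -
      obtain y where y: "a m \<bullet> y = b m" "a i \<bullet> y \<noteq> b i" using Suc.prems(2)[OF i] by blast
      have "a m \<bullet> (y - x) = 0" using x y by (simp add: inner_simps)
      then obtain t where "y - x = t *\<^sub>R u" using orthogonal_parallel[OF am u] by blast
      then have "y = x + t *\<^sub>R u" by (simp add: algebra_simps)
      then have "poly (L i) t \<noteq> 0" using y by (simp add: L)
      then show ?thesis by auto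
    qed
    moreover have "(\<Prod>i<m. L i) * Q = 0"
    proof -
      have "poly ((\<Prod>i<m. L i) * Q) t = 0" for t
      proof -
        have "a m \<bullet> (x + t *\<^sub>R u) = b m" using x u by (simp add: inner_simps)
        then have "p (x + t *\<^sub>R u) = 0" using Suc.prems(3)[of m] by blast
        then show ?thesis using pq[of "x + t *\<^sub>R u"] by (simp add: poly_prod L Q)
      qed
      then show ?thesis using poly_all_0_iff_0 by blast
    qed
    ultimately have "Q = 0" by auto
    then show ?thesis using Q[of 0] by simp
  qed
  then obtain q' where "deg_less (n - m - 1) q'" "\<And>x. q x = (b m - a m \<bullet> x) * q' x"
    using deg_less_factor[OF q am, of "b m"] by metis
  then show ?case using pq by (intro exI[of _ q']) (simp add: mult.assoc)
qed

text \<open>The row \<open>j = 0\<close> of the triangular lattice has \<open>n\<close> points, so the polynomial vanishes on its line and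
  is divisible by its equation. The quotient vanishes on the remaining rows, which form
  the lattice of the next lower order based at \<open>y + w\<close>.\<close>

lemma deg_less_lattice_unisolvent:
  fixes a u w :: "real^2"
  assumes "deg_less n p" and "a \<bullet> u = 0" "u \<noteq> 0" "a \<bullet> w \<noteq> 0"
    and "\<And>i j. i + j < n \<Longrightarrow> p (y + real i *\<^sub>R u + real j *\<^sub>R w) = 0"
  shows "p x = 0"
  using assms(1,5)
proof (induction n arbitrary: p y x)
  case 0
  then show ?case by (simp add: deg_less_0_imp_zero)
next
  case (Suc n)
  have a: "a \<noteq> 0" using assms(4) by auto
  have "p z = 0" if z: "a \<bullet> z = a \<bullet> y" for z
  proof -
    have "a \<bullet> (z - y) = 0" using z by (simp add: inner_simps)
    then obtain t where "z - y = t *\<^sub>R u" using orthogonal_parallel[OF a assms(3,2)] by blast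
    then have t: "z = y + t *\<^sub>R u" by (simp add: algebra_simps)
    obtain Q where Q: "\<And>m. Suc n \<le> m \<Longrightarrow> coeff Q m = 0" "\<And>t. poly Q t = p (y + t *\<^sub>R u)"
      using deg_less_leading_form[OF Suc.prems(1)] by metis
    have "Q = 0"
    proof (rule poly_eq_0_if_many_zeros)
      show "Suc n \<le> card (real ` {..n})" by (simp add: card_image)
    qed (use Q Suc.prems(2)[of _ 0] in auto)
    then show ?thesis using Q(2)[of t] t by simp
  qed
  then obtain q where q: "deg_less n q" and pq: "\<And>x. p x = (a \<bullet> y - a \<bullet> x) * q x"
    using deg_less_factor[OF Suc.prems(1) a, of "a \<bullet> y"] by auto
  have "q (y + w + real i *\<^sub>R u + real j *\<^sub>R w) = 0" if "i + j < n" for i j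
  proof -
    have "p (y + real i *\<^sub>R u + real (Suc j) *\<^sub>R w) = 0" using Suc.prems(2)[of i "Suc j"] that by simp
    moreover have "y + real i *\<^sub>R u + real (Suc j) *\<^sub>R w = y + w + real i *\<^sub>R u + real j *\<^sub>R w"
      by (simp add: algebra_simps)
    ultimately have "(a \<bullet> y - a \<bullet> (y + w + real i *\<^sub>R u + real j *\<^sub>R w)) *
        q (y + w + real i *\<^sub>R u + real j *\<^sub>R w) = 0"
      using pq by metis
    moreover have "a \<bullet> y - a \<bullet> (y + w + real i *\<^sub>R u + real j *\<^sub>R w) = - (real (Suc j) * (a \<bullet> w))"
      using assms(2) by (simp add: inner_simps algebra_simps)
    ultimately show ?thesis using assms(4) by simp
  qed
  then have "q x = 0" using Suc.IH[OF q] by blast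
  then show ?case using pq by simp
qed

section \<open>Polynomials on two opposite edges of a quadrilateral\<close>

text \<open>The parameter runs from -1 at \<open>A\<close> to 1 at \<open>B\<close>, as on the sides of the reference square; values beyond
  this range reach the rest of the line.\<close>

definition edge_pt :: "real^2 \<Rightarrow> real^2 \<Rightarrow> real \<Rightarrow> real^2" where
  "edge_pt A B t = ((1 - t) / 2) *\<^sub>R A + ((1 + t) / 2) *\<^sub>R B"

text \<open>Up to sign, the trace of a supplement on the two edges where it is not identically zero.\<close>

definition edge_bubble :: "nat \<Rightarrow> real \<Rightarrow> real" where
  "edge_bubble r t = (1 - t^2) * t^(r - 2)"

lemma edge_pt_line: "edge_pt A B t = edge_pt A B 0 + t *\<^sub>R ((1/2) *\<^sub>R (B - A))"
proof (rule vec_eq_iff[THEN iffD2], rule allI)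
  fix i show "edge_pt A B t $ i = (edge_pt A B 0 + t *\<^sub>R ((1/2) *\<^sub>R (B - A))) $ i"
    by (simp add: edge_pt_def field_simps)
qed

lemma edge_pt_from_start: "A + t *\<^sub>R (B - A) = edge_pt A B (2 * t - 1)"
proof -
  have "(1 - (2 * t - 1)) / 2 = 1 - t" "(1 + (2 * t - 1)) / 2 = t"
    by (simp_all add: field_simps)
  then show ?thesis unfolding edge_pt_def by (simp only:) (simp add: algebra_simps)
qed

lemma inner_edge_pt: "n \<bullet> edge_pt A B t = (1 - t) / 2 * (n \<bullet> A) + (1 + t) / 2 * (n \<bullet> B)"
  by (simp add: edge_pt_def inner_simps)

lemma edge_bubble_poly:
  assumes "2 \<le> r"
  obtains W where "\<And>t. poly W t = edge_bubble r t" "\<And>m. r < m \<Longrightarrow> coeff W m = 0" "coeff W r = - 1"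
proof
  let ?W = "monom 1 (r - 2) - monom 1 r :: real poly"
  obtain k where "r = k + 2" using assms le_Suc_ex[of 2 r] by (auto simp: add.commute)
  then show "poly ?W t = edge_bubble r t" for t
    by (simp add: edge_bubble_def poly_monom power2_eq_square algebra_simps)
qed (use assms in auto)

text \<open>Both sides are polynomials of degree at most \<open>r\<close> in the edge parameter, so agreement at the
  \<open>r + 1\<close> equally spaced nodes extends to the whole line.\<close>

lemma edge_restriction:
  assumes p: "deg_less (Suc r) p" and r: "2 \<le> r"
    and nodes: "\<And>j. j \<le> r \<Longrightarrow> p (edge_pt A B (2 * real j / real r - 1)) = c * edge_bubble r (2 * real j / real r - 1)"
  shows "p (edge_pt A B t) = c * edge_bubble r t"
proof -
  obtain Q where Q: "\<And>m. Suc r \<le> m \<Longrightarrow> coeff Q m = 0" "\<And>t. poly Q t = p (edge_pt A B t)"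
    using deg_less_leading_form[OF p] edge_pt_line by metis
  obtain W where W: "\<And>t. poly W t = edge_bubble r t" "\<And>m. r < m \<Longrightarrow> coeff W m = 0"
    using edge_bubble_poly[OF r] by metis
  let ?Z = "(\<lambda>j. 2 * real j / real r - 1) ` {..r}"
  have "inj_on (\<lambda>j. 2 * real j / real r - 1) {..r}"
    using r by (intro inj_onI) (simp add: field_simps)
  then have "Suc r \<le> card ?Z" by (simp add: card_image)
  then have "Q - smult c W = 0"
    using Q W nodes by (intro poly_eq_0_if_many_zeros[of "Suc r" _ ?Z]) auto
  then show ?thesis using Q(2)[of t] W(1)[of t] by simp
qed

text \<open>The edges \<open>A0 A1\<close> and \<open>B0 B1\<close> are opposite; \<open>n0\<close>, \<open>n1\<close> and \<open>g\<close> are outer normals of the edges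
  \<open>A0 B0\<close>, \<open>A1 B1\<close> and \<open>B0 B1\<close>. The polynomial has opposite traces on the two edges, which is
  refuted at the intersection of their lines, or at infinity, unless \<open>c = 0\<close>.\<close>

lemma opposite_edges:
  fixes A0 A1 B0 B1 n0 n1 g :: "real^2"
  assumes p: "deg_less (Suc r) p" and r: "2 \<le> r"
    and n0: "n0 \<bullet> A0 = c0" "n0 \<bullet> B0 = c0" "n0 \<bullet> A1 < c0" "n0 \<bullet> B1 < c0"
    and n1: "n1 \<bullet> A1 = c1" "n1 \<bullet> B1 = c1" "n1 \<bullet> A0 < c1" "n1 \<bullet> B0 < c1"
    and g: "g \<bullet> B0 = cg" "g \<bullet> B1 = cg" "g \<bullet> A0 < cg" "g \<bullet> A1 < cg"
    and pA: "\<And>t. p (edge_pt A0 A1 t) = c * edge_bubble r t"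
    and pB: "\<And>t. p (edge_pt B0 B1 t) = - c * edge_bubble r t"
  shows "c = 0"
proof -
  have e: "B1 - B0 \<noteq> 0" using n0 by auto
  have ge: "g \<bullet> (B1 - B0) = 0" using g by (simp add: inner_simps)
  have g0: "g \<noteq> 0" using g by auto
  show ?thesis
  proof (cases "g \<bullet> A0 = g \<bullet> A1")
    case True
    then have "g \<bullet> (A1 - A0) = 0" by (simp add: inner_simps)
    then obtain s where s: "A1 - A0 = s *\<^sub>R (B1 - B0)" using orthogonal_parallel[OF g0 e ge] by blast
    have "n0 \<bullet> (A1 - A0) < 0" "n0 \<bullet> (B1 - B0) < 0" using n0 by (simp_all add: inner_simps)
    then have "s > 0" unfolding s by (simp add: mult_less_0_iff)
    obtain h where hom: "\<And>s u. h (s *\<^sub>R u) = s ^ (Suc r - 1) * h u"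
      and h: "\<And>y u. \<exists>q. (\<forall>m\<ge>Suc r. coeff q m = 0) \<and> (\<forall>t. poly q t = p (y + t *\<^sub>R u)) \<and> coeff q (Suc r - 1) = h u"
      using deg_less_leading_form[OF p] by metis
    \<comment> \<open>The top coefficient along an edge is \<open>h\<close> at half the edge vector; that of the bubble is -1.\<close>
    have lead: "h ((1/2) *\<^sub>R (B - A)) = - d" if pe: "\<And>t. p (edge_pt A B t) = d * edge_bubble r t" for A B d
    proof -
      obtain Q where Q: "\<forall>t. poly Q t = p (edge_pt A B 0 + t *\<^sub>R ((1/2) *\<^sub>R (B - A)))"
          "coeff Q (Suc r - 1) = h ((1/2) *\<^sub>R (B - A))"
        using h by blast
      obtain W where W: "\<And>t. poly W t = edge_bubble r t" "coeff W r = - 1"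
        using edge_bubble_poly[OF r] by metis
      have "poly Q t = poly (smult d W) t" for t
        using Q(1) pe[of t] W(1)[of t] edge_pt_line[of A B t] by (metis poly_smult)
      then have "Q = smult d W" using poly_eq_poly_eq_iff by blast
      then show ?thesis using Q(2) W(2) by simp
    qed
    have "- c = h ((1/2) *\<^sub>R (A1 - A0))" using lead[OF pA] by simp
    also have "\<dots> = h (s *\<^sub>R ((1/2) *\<^sub>R (B1 - B0)))" by (simp add: s mult.commute)
    also have "\<dots> = s ^ r * h ((1/2) *\<^sub>R (B1 - B0))" by (subst hom) simp
    also have "\<dots> = s ^ r * c" using lead[OF pB] by simp
    finally have "(1 + s ^ r) * c = 0" by (simp add: algebra_simps)
    moreover have "1 + s ^ r > 0" using \<open>s > 0\<close> by (simp add: add_pos_pos)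
    ultimately show ?thesis by simp
  next
    case False
    \<comment> \<open>The parameter at which the line \<open>A0 A1\<close> meets the line \<open>B0 B1\<close>.\<close>
    define s where "s = (2 * cg - g \<bullet> A0 - g \<bullet> A1) / (g \<bullet> A1 - g \<bullet> A0)"
    define X where "X = edge_pt A0 A1 s"
    have "s * (g \<bullet> A1 - g \<bullet> A0) = 2 * cg - g \<bullet> A0 - g \<bullet> A1" using False by (simp add: s_def)
    then have gX: "g \<bullet> X = cg" by (simp add: X_def inner_edge_pt field_simps)
    then have "g \<bullet> (X - B0) = 0" using g by (simp add: inner_simps)
    then obtain \<tau> where \<tau>: "X - B0 = \<tau> *\<^sub>R (B1 - B0)" using orthogonal_parallel[OF g0 e ge] by blast
    define t where "t = 2 * \<tau> - 1"
    have X': "X = edge_pt B0 B1 t"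
    proof -
      have "X = B0 + \<tau> *\<^sub>R (B1 - B0)" using \<tau> by (metis add.commute diff_add_cancel)
      then show ?thesis by (simp add: edge_pt_from_start t_def)
    qed
    \<comment> \<open>Seen from \<open>A0 B0\<close>, and below from \<open>A1 B1\<close>, the point lies on the same side for both parameters.\<close>
    have "c0 - n0 \<bullet> X = (1 + s) / 2 * (c0 - n0 \<bullet> A1)" "c0 - n0 \<bullet> X = (1 + t) / 2 * (c0 - n0 \<bullet> B1)"
      using n0 unfolding X_def by (simp add: inner_edge_pt field_simps)
        (use n0 in \<open>simp add: X_def[symmetric] X' inner_edge_pt field_simps\<close>)
    then have sg0: "0 < 1 + s \<longleftrightarrow> 0 < 1 + t" "1 + s < 0 \<longleftrightarrow> 1 + t < 0"
      using n0 by (smt (verit) divide_less_0_iff zero_less_divide_iff zero_less_mult_iff mult_less_0_iff)+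
    have "c1 - n1 \<bullet> X = (1 - s) / 2 * (c1 - n1 \<bullet> A0)" "c1 - n1 \<bullet> X = (1 - t) / 2 * (c1 - n1 \<bullet> B0)"
      using n1 unfolding X_def by (simp add: inner_edge_pt field_simps)
        (use n1 in \<open>simp add: X_def[symmetric] X' inner_edge_pt field_simps\<close>)
    then have sg1: "0 < 1 - s \<longleftrightarrow> 0 < 1 - t" "1 - s < 0 \<longleftrightarrow> 1 - t < 0"
      using n1 by (smt (verit) divide_less_0_iff zero_less_divide_iff zero_less_mult_iff mult_less_0_iff)+
    have "(1 - s) * (cg - g \<bullet> A0) + (1 + s) * (cg - g \<bullet> A1) = 0"
      using gX unfolding X_def inner_edge_pt by (simp add: field_simps)
    \<comment> \<open>The closed edge \<open>A0 A1\<close> lies strictly on the inner side of the line \<open>B0 B1\<close>, so \<open>s\<close> is outside \<open>[-1, 1]\<close>.\<close>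
    moreover have "(1 - s) * (cg - g \<bullet> A0) + (1 + s) * (cg - g \<bullet> A1) > 0" if "-1 \<le> s" "s \<le> 1"
      using that g by (smt (verit) mult_nonneg_nonneg mult_pos_pos)
    ultimately have "s < -1 \<or> s > 1" by fastforce
    then have st: "(s < -1 \<and> t < -1) \<or> (s > 1 \<and> t > 1)" using sg0 sg1 by linarith
    then have "s * t > 0" by (auto simp: zero_less_mult_iff)
    moreover have "1 - s^2 < 0" "1 - t^2 < 0"
    proof -
      have "1 < \<bar>s\<bar>" "1 < \<bar>t\<bar>" using st by linarith+
      then have "1 < \<bar>s\<bar>^2" "1 < \<bar>t\<bar>^2" by (metis one_less_power pos2)+
      then show "1 - s^2 < 0" "1 - t^2 < 0" by simp_all
    qed
    ultimately have "edge_bubble r s * edge_bubble r t > 0"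
    proof -
      have "edge_bubble r s * edge_bubble r t = ((1 - s^2) * (1 - t^2)) * (s * t)^(r - 2)"
        by (simp add: edge_bubble_def power_mult_distrib)
      then show ?thesis using \<open>s * t > 0\<close> \<open>1 - s^2 < 0\<close> \<open>1 - t^2 < 0\<close>
        by (simp add: mult_neg_neg)
    qed
    then have "edge_bubble r s + edge_bubble r t \<noteq> 0"
      by (auto simp: zero_less_mult_iff)
    moreover have "c * (edge_bubble r s + edge_bubble r t) = 0"
      using pA[of s] pB[of t] X' X_def by (simp add: distrib_left)
    ultimately show ?thesis by simp
  qed
qed

section \<open>Nodes on edges and in triangles\<close>

lemma edge_pt_nodes:
  assumes "2 \<le> r" "j \<le> r"
  shows "edge_pt A B (2 * real j / real r - 1) \<in> {A, B} \<union> edge_nodes r A B"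
proof -
  have "(1 - (2 * real j / real r - 1)) / 2 = 1 - real j / real r" "(1 + (2 * real j / real r - 1)) / 2 = real j / real r"
    by (simp_all add: field_simps)
  then have eq: "edge_pt A B (2 * real j / real r - 1) = (1 - real j / real r) *\<^sub>R A + (real j / real r) *\<^sub>R B"
    unfolding edge_pt_def by (simp only:)
  consider "j = 0" | "j = r" | "j \<in> {1..r - 1}" using assms by fastforce
  then show ?thesis unfolding eq using assms by cases (auto simp: edge_nodes_def)
qed

lemma edge_nodes_commute: "edge_nodes r A B = edge_nodes r B A"
proof -
  have "edge_nodes r A B \<subseteq> edge_nodes r B A" for A B
  proof
    fix x assume "x \<in> edge_nodes r A B"
    then obtain j where j: "j \<in> {1..r - 1}" "x = (1 - real j / real r) *\<^sub>R A + (real j / real r) *\<^sub>R B"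
      by (auto simp: edge_nodes_def)
    then have "r - j \<in> {1..r - 1}" "1 - real (r - j) / real r = real j / real r" "real (r - j) / real r = 1 - real j / real r"
      by (auto simp: of_nat_diff field_simps)
    then show "x \<in> edge_nodes r B A" unfolding edge_nodes_def
      using j(2) by (intro image_eqI[of _ _ "r - j"]) (simp_all add: add.commute)
  qed
  then show ?thesis by blast
qed

lemma lagrange_nodes_subset_hull: "lagrange_nodes m a b c \<subseteq> convex hull {a, b, c}"
proof
  fix x assume x: "x \<in> lagrange_nodes m a b c"
  show "x \<in> convex hull {a, b, c}"
  proof (cases "m = 0")
    case True
    then show ?thesis using x unfolding lagrange_nodes_def convex_hull_3
      by (intro CollectI exI[of _ "1/3"]) (simp add: algebra_simps)
  next
    case False
    then obtain i j k where ijk: "i + j + k = m"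
        "x = (real i / real m) *\<^sub>R a + (real j / real m) *\<^sub>R b + (real k / real m) *\<^sub>R c"
      using x by (auto simp: lagrange_nodes_def)
    then have "real i / real m + real j / real m + real k / real m = 1"
      using False by (simp flip: add_divide_distrib of_nat_add)
    then show ?thesis unfolding convex_hull_3 using ijk(2)
      by (intro CollectI exI[of _ "real i / real m"] exI[of _ "real j / real m"] exI[of _ "real k / real m"]) auto
  qed
qed

text \<open>The nodes form a triangular lattice with corner \<open>c\<close> and steps \<open>(a - c) / m\<close> and \<open>(b - c) / m\<close>;
  non-collinearity makes the steps independent.\<close>

lemma lagrange_nodes_unisolvent:
  assumes q: "deg_less (Suc m) q" and nc: "\<not> collinear {a, b, c}"
    and zero: "\<And>x. x \<in> lagrange_nodes m a b c \<Longrightarrow> q x = 0"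
  shows "q x = 0"
proof -
  have ac: "a - c \<noteq> 0" using nc by (auto simp: insert_commute)
  obtain e where e: "e \<noteq> 0" "(a - c) \<bullet> e = 0" using orthogonal_direction[OF ac] by blast
  have eac: "e \<bullet> (a - c) = 0" using e(2) by (simp add: inner_commute)
  have ebc: "e \<bullet> (b - c) \<noteq> 0"
  proof
    assume "e \<bullet> (b - c) = 0"
    then obtain t where "b - c = t *\<^sub>R (a - c)" using orthogonal_parallel[OF e(1) ac eac] by blast
    then have "collinear {a, c, b}" by (subst collinear_3) (auto simp: collinear_lemma)
    then show False using nc by (simp add: insert_commute)
  qed
  show ?thesis
  proof (cases "m = 0")
    case True
    show ?thesis
    proof (rule deg_less_lattice_unisolvent[OF q eac ac ebc])
      fix i j assume "i + j < Suc m"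
      then show "q ((1/3) *\<^sub>R (a + b + c) + real i *\<^sub>R (a - c) + real j *\<^sub>R (b - c)) = 0"
        using True zero by (simp add: lagrange_nodes_def)
    qed
  next
    case False
    show ?thesis
    proof (rule deg_less_lattice_unisolvent[OF q])
      show "e \<bullet> ((1 / real m) *\<^sub>R (a - c)) = 0" "(1 / real m) *\<^sub>R (a - c) \<noteq> 0" "e \<bullet> ((1 / real m) *\<^sub>R (b - c)) \<noteq> 0"
        using False eac ac ebc by simp_all
      fix i j assume ij: "i + j < Suc m"
      define \<alpha> \<gamma> where "\<alpha> = real i / real m" and "\<gamma> = real j / real m"
      have k: "real (m - i - j) / real m = 1 - \<alpha> - \<gamma>"
        using ij False by (simp add: \<alpha>_def \<gamma>_def of_nat_diff field_simps)
      have "c + real i *\<^sub>R (1 / real m) *\<^sub>R (a - c) + real j *\<^sub>R (1 / real m) *\<^sub>R (b - c) =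
          c + \<alpha> *\<^sub>R (a - c) + \<gamma> *\<^sub>R (b - c)"
        by (simp add: \<alpha>_def \<gamma>_def)
      also have "\<dots> = \<alpha> *\<^sub>R a + \<gamma> *\<^sub>R b + (1 - \<alpha> - \<gamma>) *\<^sub>R c"
        by (simp add: algebra_simps)
      also have "\<dots> \<in> lagrange_nodes m a b c"
      proof -
        have "i + j + (m - i - j) = m" using ij by simp
        then show ?thesis unfolding k[symmetric] unfolding \<alpha>_def \<gamma>_def lagrange_nodes_def if_not_P[OF False]
          by blast
      qed
      finally show "q (c + real i *\<^sub>R (1 / real m) *\<^sub>R (a - c) + real j *\<^sub>R (1 / real m) *\<^sub>R (b - c)) = 0"
        by (rule zero)
    qed
  qed
qed

section \<open>The monomial basis of the polynomial space\<close>

definition exponents :: "nat \<Rightarrow> (nat \<times> nat) set" where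
  "exponents r = (SIGMA i:{..r}. {..r - i})"

definition monomial :: "(real^2) set \<Rightarrow> nat \<times> nat \<Rightarrow> real^2 \<Rightarrow> real" where
  "monomial E = (\<lambda>(i, j). on_set E (\<lambda>x. (x$1)^i * (x$2)^j))"

lemma finite_exponents: "finite (exponents r)"
  by (simp add: exponents_def)

lemma card_exponents: "2 * card (exponents r) = (r + 1) * (r + 2)"
proof -
  have "2 * (\<Sum>i\<le>r. Suc (r - i)) = (r + 1) * (r + 2)"
    by (induction r) (simp_all add: sum.atMost_Suc_shift del: sum.atMost_Suc)
  then show ?thesis by (simp add: exponents_def)
qed

lemma sum_apply: "(\<Sum>i\<in>A. f i) x = (\<Sum>i\<in>A. f i x :: real)"
  by (induction A rule: infinite_finite_induct) auto

lemma sum_monomials: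
  "(\<Sum>k\<in>exponents r. fun_scale (c k) (monomial E k)) =
     on_set E (\<lambda>x. \<Sum>i\<le>r. \<Sum>j\<le>r - i. c (i, j) * (x$1)^i * (x$2)^j)"
proof
  fix x
  have "(\<Sum>k\<in>exponents r. fun_scale (c k) (monomial E k)) x =
      (\<Sum>(i, j)\<in>exponents r. c (i, j) * monomial E (i, j) x)"
    by (simp add: sum_apply fun_scale_def case_prod_unfold)
  also have "\<dots> = (\<Sum>i\<le>r. \<Sum>j\<le>r - i. c (i, j) * monomial E (i, j) x)"
    unfolding exponents_def by (subst sum.Sigma) auto
  finally show "(\<Sum>k\<in>exponents r. fun_scale (c k) (monomial E k)) x =
      on_set E (\<lambda>x. \<Sum>i\<le>r. \<Sum>j\<le>r - i. c (i, j) * (x$1)^i * (x$2)^j) x"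
    by (simp add: monomial_def on_set_def mult.assoc)
qed

lemma coefficients_zero:
  fixes c :: "nat \<times> nat \<Rightarrow> real"
  assumes "\<And>x :: real^2. (\<Sum>i\<le>r. \<Sum>j\<le>r - i. c (i, j) * (x$1)^i * (x$2)^j) = 0" and k: "k \<in> exponents r"
  shows "c k = 0"
proof -
  have row: "(\<Sum>j\<le>r - i. c (i, j) * t^j) = 0" if "i \<le> r" for i t
  proof -
    have "\<forall>s. (\<Sum>i\<le>r. (\<Sum>j\<le>r - i. c (i, j) * t^j) * s^i) = 0"
    proof
      fix s show "(\<Sum>i\<le>r. (\<Sum>j\<le>r - i. c (i, j) * t^j) * s^i) = 0"
        using assms(1)[of "vector [s, t]"] by (simp add: sum_distrib_left sum_distrib_right mult_ac)
    qed
    then show ?thesis using that polyfun_eq_0[of "\<lambda>i. \<Sum>j\<le>r - i. c (i, j) * t^j" r] by blast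
  qed
  obtain i j where ij: "k = (i, j)" "i \<le> r" "j \<le> r - i" using k by (auto simp: exponents_def)
  then show ?thesis using row polyfun_eq_0[of "\<lambda>j. c (i, j)" "r - i"] by blast
qed

lemma poly_space_eq: "poly_space r E = fun_space.span (monomial E ` exponents r)"
proof
  have eq: "poly_space r E = range (\<lambda>c. \<Sum>k\<in>exponents r. fun_scale (c k) (monomial E k))"
  proof -
    have "p \<in> poly_space r E \<longleftrightarrow> (\<exists>c. p = (\<Sum>k\<in>exponents r. fun_scale (c k) (monomial E k)))" for p
    proof
      assume "p \<in> poly_space r E"
      then obtain c where "p = on_set E (\<lambda>x. \<Sum>i\<le>r. \<Sum>j\<le>r - i. c i j * (x$1)^i * (x$2)^j)"
        by (auto simp: poly_space_def)
      then have "p = (\<Sum>k\<in>exponents r. fun_scale (case_prod c k) (monomial E k))"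
        by (simp add: sum_monomials)
      then show "\<exists>c. p = (\<Sum>k\<in>exponents r. fun_scale (c k) (monomial E k))" by blast
    next
      assume "\<exists>c. p = (\<Sum>k\<in>exponents r. fun_scale (c k) (monomial E k))"
      then obtain c where "p = (\<Sum>k\<in>exponents r. fun_scale (c k) (monomial E k))" by blast
      then show "p \<in> poly_space r E" unfolding poly_space_def sum_monomials
        by (intro CollectI exI[of _ "curry c"]) simp
    qed
    then show ?thesis by auto
  qed
  show "poly_space r E \<subseteq> fun_space.span (monomial E ` exponents r)"
    unfolding eq by (auto intro!: fun_space.span_sum fun_space.span_scale intro: fun_space.span_base)
  have "fun_space.subspace (poly_space r E)"
    unfolding eq
  proof (rule fun_space.subspaceI)
    show "0 \<in> range (\<lambda>c. \<Sum>k\<in>exponents r. fun_scale (c k) (monomial E k))"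
      by (rule range_eqI[of _ _ "\<lambda>k. 0"]) simp
    show "x + y \<in> range (\<lambda>c. \<Sum>k\<in>exponents r. fun_scale (c k) (monomial E k))"
      if xy: "x \<in> range (\<lambda>c. \<Sum>k\<in>exponents r. fun_scale (c k) (monomial E k))"
        "y \<in> range (\<lambda>c. \<Sum>k\<in>exponents r. fun_scale (c k) (monomial E k))" for x y
    proof -
      obtain c d where "x = (\<Sum>k\<in>exponents r. fun_scale (c k) (monomial E k))"
        "y = (\<Sum>k\<in>exponents r. fun_scale (d k) (monomial E k))" using xy by blast
      then show ?thesis
        by (intro range_eqI[of _ _ "\<lambda>k. c k + d k"]) (simp add: fun_space.scale_left_distrib sum.distrib)
    qed
    show "fun_scale s x \<in> range (\<lambda>c. \<Sum>k\<in>exponents r. fun_scale (c k) (monomial E k))"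
      if x: "x \<in> range (\<lambda>c. \<Sum>k\<in>exponents r. fun_scale (c k) (monomial E k))" for x s
    proof -
      obtain c where "x = (\<Sum>k\<in>exponents r. fun_scale (c k) (monomial E k))" using x by blast
      then show ?thesis
        by (intro range_eqI[of _ _ "\<lambda>k. s * c k"]) (simp add: fun_space.scale_sum_right)
    qed
  qed
  moreover have "monomial E ` exponents r \<subseteq> poly_space r E"
  proof
    fix p assume "p \<in> monomial E ` exponents r"
    then obtain k where k: "k \<in> exponents r" "p = monomial E k" by blast
    have "p = (\<Sum>l\<in>exponents r. fun_scale (if l = k then 1 else 0) (monomial E l))"
      using k finite_exponents[of r]
      by (subst sum.remove[of _ k]) (auto intro!: sum.neutral)
    then show "p \<in> poly_space r E"
      unfolding eq by (intro range_eqI[of _ _ "\<lambda>l. if l = k then 1 else 0"])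
  qed
  ultimately show "fun_space.span (monomial E ` exponents r) \<subseteq> poly_space r E"
    by (rule fun_space.span_minimal[rotated])
qed

section \<open>The bilinear map of a quadrilateral\<close>

lemma ref_square_iff: "x \<in> ref_square \<longleftrightarrow> -1 \<le> x$1 \<and> x$1 \<le> 1 \<and> -1 \<le> x$2 \<and> x$2 \<le> (1::real)"
  by (auto simp: ref_square_def forall_2 abs_le_iff)

lemma combination_pos:
  fixes t a b :: real
  assumes "-1 \<le> t" "t \<le> 1" "0 < a" "0 < b"
  shows "0 < (1 - t) * a + (1 + t) * b" "0 < (1 + t) * a + (1 - t) * b"
  using assms by (smt (verit) mult_nonneg_nonneg mult_pos_pos)+

lemma edge_pt_bilinear:
  "edge_pt (v 1) (v 2) t = bilinear_map v (vector [1, t])"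
  "edge_pt (v 0) (v 3) t = bilinear_map v (vector [-1, t])"
  "edge_pt (v 3) (v 2) t = bilinear_map v (vector [t, 1])"
  "edge_pt (v 0) (v 1) t = bilinear_map v (vector [t, -1])"
  by (simp_all add: edge_pt_def bilinear_map_def vec_eq_iff field_simps)

text \<open>The edge from \<open>v i\<close> to its successor is cut out by the supporting line \<open>n i \<bullet> x = \<beta> i\<close>, on whose inner
  side \<open>n i \<bullet> x < \<beta> i\<close> the other two vertices lie.\<close>

locale supported_quadrilateral =
  fixes E :: "(real^2) set" and v :: "nat \<Rightarrow> real^2" and n :: "nat \<Rightarrow> real^2" and \<beta> :: "nat \<Rightarrow> real"
  assumes convex: "convex E" and vertex: "\<And>i. i < 4 \<Longrightarrow> v i \<in> E"
    and supp: "\<And>i x. i < 4 \<Longrightarrow> x \<in> E \<Longrightarrow> n i \<bullet> x \<le> \<beta> i"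
    and on_edge: "\<And>i. i < 4 \<Longrightarrow> n i \<bullet> v i = \<beta> i" "\<And>i. i < 4 \<Longrightarrow> n i \<bullet> v (Suc i mod 4) = \<beta> i"
    and off_edge: "\<And>i j. i < 4 \<Longrightarrow> j < 4 \<Longrightarrow> j \<noteq> i \<Longrightarrow> j \<noteq> Suc i mod 4 \<Longrightarrow> n i \<bullet> v j < \<beta> i"
begin

lemma edge_values:
  "n 0 \<bullet> v 0 = \<beta> 0" "n 0 \<bullet> v 1 = \<beta> 0" "n 0 \<bullet> v 2 < \<beta> 0" "n 0 \<bullet> v 3 < \<beta> 0"
  "n 1 \<bullet> v 1 = \<beta> 1" "n 1 \<bullet> v 2 = \<beta> 1" "n 1 \<bullet> v 0 < \<beta> 1" "n 1 \<bullet> v 3 < \<beta> 1"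
  "n 2 \<bullet> v 2 = \<beta> 2" "n 2 \<bullet> v 3 = \<beta> 2" "n 2 \<bullet> v 0 < \<beta> 2" "n 2 \<bullet> v 1 < \<beta> 2"
  "n 3 \<bullet> v 3 = \<beta> 3" "n 3 \<bullet> v 0 = \<beta> 3" "n 3 \<bullet> v 1 < \<beta> 3" "n 3 \<bullet> v 2 < \<beta> 3"
proof -
  have s: "Suc 0 mod 4 = (1::nat)" "Suc 1 mod 4 = (2::nat)" "Suc 2 mod 4 = (3::nat)" "Suc 3 mod 4 = (0::nat)"
    by simp_all
  show "n 0 \<bullet> v 0 = \<beta> 0" "n 1 \<bullet> v 1 = \<beta> 1" "n 2 \<bullet> v 2 = \<beta> 2" "n 3 \<bullet> v 3 = \<beta> 3"
    by (rule on_edge(1), simp)+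
  show "n 0 \<bullet> v 1 = \<beta> 0" "n 1 \<bullet> v 2 = \<beta> 1" "n 2 \<bullet> v 3 = \<beta> 2" "n 3 \<bullet> v 0 = \<beta> 3"
    using on_edge(2)[of 0, unfolded s] on_edge(2)[of 1, unfolded s]
      on_edge(2)[of 2, unfolded s] on_edge(2)[of 3, unfolded s] by simp_all
  show "n 0 \<bullet> v 2 < \<beta> 0" "n 0 \<bullet> v 3 < \<beta> 0" "n 1 \<bullet> v 0 < \<beta> 1" "n 1 \<bullet> v 3 < \<beta> 1"
    "n 2 \<bullet> v 0 < \<beta> 2" "n 2 \<bullet> v 1 < \<beta> 2" "n 3 \<bullet> v 1 < \<beta> 3" "n 3 \<bullet> v 2 < \<beta> 3"
    using off_edge[of 0 2, unfolded s] off_edge[of 0 3, unfolded s] off_edge[of 1 0, unfolded s]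
      off_edge[of 1 3, unfolded s] off_edge[of 2 0, unfolded s] off_edge[of 2 1, unfolded s]
      off_edge[of 3 1, unfolded s] off_edge[of 3 2, unfolded s] by simp_all
qed

lemma normal_nonzero: "i < 4 \<Longrightarrow> n i \<noteq> 0"
proof -
  assume "i < 4"
  then have "i = 0 \<or> i = 1 \<or> i = 2 \<or> i = 3" by linarith
  then show ?thesis using edge_values by auto
qed

lemma bilinear_map_in: "x \<in> ref_square \<Longrightarrow> bilinear_map v x \<in> E"
proof -
  assume x: "x \<in> ref_square"
  then have b: "-1 \<le> x$1" "x$1 \<le> 1" "-1 \<le> x$2" "x$2 \<le> 1" by (auto simp: ref_square_iff)
  have edge: "edge_pt y z t \<in> E" if "y \<in> E" "z \<in> E" "-1 \<le> t" "t \<le> 1" for y z t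
    unfolding edge_pt_def using that by (intro convexD[OF convex]) (auto simp: field_simps)
  have "bilinear_map v x = edge_pt (edge_pt (v 0) (v 1) (x$1)) (edge_pt (v 3) (v 2) (x$1)) (x$2)"
    by (simp add: bilinear_map_def edge_pt_def algebra_simps scaleR_add_left[symmetric] divide_simps)
  then show ?thesis using b vertex by (simp add: edge)
qed

text \<open>Each edge functional, pulled back to the reference square, is the equation of the corresponding side
  times a function that is positive on the square.\<close>

lemma support_bilinear_map:
  "\<beta> 0 - n 0 \<bullet> bilinear_map v x = (1 + x$2) / 4 * ((1 + x$1) * (\<beta> 0 - n 0 \<bullet> v 2) + (1 - x$1) * (\<beta> 0 - n 0 \<bullet> v 3))"
  "\<beta> 1 - n 1 \<bullet> bilinear_map v x = (1 - x$1) / 4 * ((1 - x$2) * (\<beta> 1 - n 1 \<bullet> v 0) + (1 + x$2) * (\<beta> 1 - n 1 \<bullet> v 3))"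
  "\<beta> 2 - n 2 \<bullet> bilinear_map v x = (1 - x$2) / 4 * ((1 - x$1) * (\<beta> 2 - n 2 \<bullet> v 0) + (1 + x$1) * (\<beta> 2 - n 2 \<bullet> v 1))"
  "\<beta> 3 - n 3 \<bullet> bilinear_map v x = (1 + x$1) / 4 * ((1 - x$2) * (\<beta> 3 - n 3 \<bullet> v 1) + (1 + x$2) * (\<beta> 3 - n 3 \<bullet> v 2))"
  by (simp_all add: bilinear_map_def inner_simps edge_values[simplified] field_simps)

text \<open>If \<open>y\<close> is on a side, the functional of the corresponding edge vanishes at its image, which puts \<open>x\<close> on
  the same side; the functional of an adjacent edge is strictly monotone along this side and
  recovers the other coordinate.\<close>

lemma bilinear_map_inj_boundary:
  assumes x: "x \<in> ref_square" and y: "y \<in> ref_square"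
    and eq: "bilinear_map v x = bilinear_map v y"
    and bd: "\<bar>y$1\<bar> = 1 \<or> \<bar>y$2\<bar> = 1"
  shows "x = y"
proof -
  note B = x[unfolded ref_square_iff] y[unfolded ref_square_iff]
  note S = support_bilinear_map
  have pos: "0 < (1 + x$1) * (\<beta> 0 - n 0 \<bullet> v 2) + (1 - x$1) * (\<beta> 0 - n 0 \<bullet> v 3)"
      "0 < (1 - x$2) * (\<beta> 1 - n 1 \<bullet> v 0) + (1 + x$2) * (\<beta> 1 - n 1 \<bullet> v 3)"
      "0 < (1 - x$1) * (\<beta> 2 - n 2 \<bullet> v 0) + (1 + x$1) * (\<beta> 2 - n 2 \<bullet> v 1)"
      "0 < (1 - x$2) * (\<beta> 3 - n 3 \<bullet> v 1) + (1 + x$2) * (\<beta> 3 - n 3 \<bullet> v 2)"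
    using B edge_values by (auto intro!: combination_pos)
  have "x$1 = y$1 \<and> x$2 = y$2"
  proof -
    consider "y$1 = 1" | "y$1 = -1" | "y$2 = 1" | "y$2 = -1" using bd by linarith
    then show ?thesis
    proof cases
      case 1
      then have "x$1 = 1" using S(2)[of x] S(2)[of y] eq pos(2) by simp
      then show ?thesis using 1 S(1)[of x] S(1)[of y] eq edge_values by simp
    next
      case 2
      then have "x$1 = -1" using S(4)[of x] S(4)[of y] eq pos(4) by simp
      then show ?thesis using 2 S(1)[of x] S(1)[of y] eq edge_values by simp
    next
      case 3
      then have "x$2 = 1" using S(3)[of x] S(3)[of y] eq pos(3) by simp
      then show ?thesis using 3 S(2)[of x] S(2)[of y] eq edge_values by simp
    next
      case 4
      then have "x$2 = -1" using S(1)[of x] S(1)[of y] eq pos(1) by simp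
      then show ?thesis using 4 S(2)[of x] S(2)[of y] eq edge_values by simp
    qed
  qed
  then show ?thesis by (simp add: vec_eq_iff forall_2)
qed

section \<open>Unisolvence\<close>

lemma push_forward_boundary:
  assumes y: "y \<in> ref_square" and bd: "\<bar>y$1\<bar> = 1 \<or> \<bar>y$2\<bar> = 1"
  shows "push_forward E v f (bilinear_map v y) = f y"
proof -
  let ?z = "inv_into ref_square (bilinear_map v) (bilinear_map v y)"
  have "?z \<in> ref_square" "bilinear_map v ?z = bilinear_map v y"
    using y by (auto intro: inv_into_into f_inv_into_f)
  then have "?z = y" using bilinear_map_inj_boundary[OF _ y _ bd] by blast
  then show ?thesis using bilinear_map_in[OF y] by (simp add: push_forward_def on_set_def)
qed

definition suppl1 where "suppl1 r = push_forward E v (\<lambda>x. (1 - (x$2)^2) * x$1 * (x$2)^(r - 2))"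
definition suppl2 where "suppl2 r = push_forward E v (\<lambda>x. (1 - (x$1)^2) * x$2 * (x$1)^(r - 2))"

lemma edge_pt_in:
  assumes "-1 \<le> t" "t \<le> 1"
  shows "edge_pt (v 1) (v 2) t \<in> E" "edge_pt (v 0) (v 3) t \<in> E"
    "edge_pt (v 3) (v 2) t \<in> E" "edge_pt (v 0) (v 1) t \<in> E"
  unfolding edge_pt_bilinear by (auto intro!: bilinear_map_in simp: ref_square_iff assms)

lemma supplements_on_edges:
  assumes "-1 \<le> t" "t \<le> 1"
  shows "suppl1 r (edge_pt (v 1) (v 2) t) = edge_bubble r t" "suppl2 r (edge_pt (v 1) (v 2) t) = 0"
    "suppl1 r (edge_pt (v 0) (v 3) t) = - edge_bubble r t" "suppl2 r (edge_pt (v 0) (v 3) t) = 0"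
    "suppl1 r (edge_pt (v 3) (v 2) t) = 0" "suppl2 r (edge_pt (v 3) (v 2) t) = edge_bubble r t"
    "suppl1 r (edge_pt (v 0) (v 1) t) = 0" "suppl2 r (edge_pt (v 0) (v 1) t) = - edge_bubble r t"
  unfolding edge_pt_bilinear suppl1_def suppl2_def edge_bubble_def
  by (simp_all add: push_forward_boundary ref_square_iff assms left_diff_distrib)

lemma line_through_edge:
  assumes "i < 4" "n i \<bullet> x = \<beta> i" "A \<noteq> B" "n i \<bullet> A = \<beta> i" "n i \<bullet> B = \<beta> i"
  obtains t where "x = edge_pt A B t"
proof -
  have "n i \<bullet> (B - A) = 0" "n i \<bullet> (x - A) = 0" using assms by (simp_all add: inner_simps)
  then obtain \<tau> where "x - A = \<tau> *\<^sub>R (B - A)"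
    using orthogonal_parallel[OF normal_nonzero[OF assms(1)], of "B - A" "x - A"] assms(3) by auto
  then have "x = A + \<tau> *\<^sub>R (B - A)" by (metis add.commute diff_add_cancel)
  then have "x = edge_pt A B (2 * \<tau> - 1)" by (simp add: edge_pt_from_start)
  then show ?thesis by (rule that)
qed

text \<open>The edges are traversed in the direction of the increasing reference coordinate, in which opposite
  traces of a supplement differ by the sign only.\<close>

lemma edge_nodes_vanish:
  assumes p: "deg_less (Suc r) p" and r: "2 \<le> r"
    and zero: "\<And>A B j. (A, B) \<in> {(v 1, v 2), (v 0, v 3), (v 3, v 2), (v 0, v 1)} \<Longrightarrow> j \<le> r \<Longrightarrow>
        (let x = edge_pt A B (2 * real j / real r - 1) in p x + c * suppl1 r x + d * suppl2 r x) = 0"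
  shows "c = 0" "d = 0" "\<And>i x. i < 4 \<Longrightarrow> n i \<bullet> x = \<beta> i \<Longrightarrow> p x = 0"
proof -
  have bd: "-1 \<le> 2 * real j / real r - 1" "2 * real j / real r - 1 \<le> 1" if "j \<le> r" for j
    using that r by (auto simp: field_simps)
  note sup = supplements_on_edges[OF bd]
  have E12: "p (edge_pt (v 1) (v 2) t) = - c * edge_bubble r t" for t
  proof (rule edge_restriction[OF p r])
    fix j assume "j \<le> r"
    then show "p (edge_pt (v 1) (v 2) (2 * real j / real r - 1)) = - c * edge_bubble r (2 * real j / real r - 1)"
      using zero[of "v 1" "v 2" j] sup[of j] by (simp add: Let_def)
  qed
  have E03: "p (edge_pt (v 0) (v 3) t) = c * edge_bubble r t" for t
  proof (rule edge_restriction[OF p r])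
    fix j assume "j \<le> r"
    then show "p (edge_pt (v 0) (v 3) (2 * real j / real r - 1)) = c * edge_bubble r (2 * real j / real r - 1)"
      using zero[of "v 0" "v 3" j] sup[of j] by (simp add: Let_def)
  qed
  have E32: "p (edge_pt (v 3) (v 2) t) = - d * edge_bubble r t" for t
  proof (rule edge_restriction[OF p r])
    fix j assume "j \<le> r"
    then show "p (edge_pt (v 3) (v 2) (2 * real j / real r - 1)) = - d * edge_bubble r (2 * real j / real r - 1)"
      using zero[of "v 3" "v 2" j] sup[of j] by (simp add: Let_def)
  qed
  have E01: "p (edge_pt (v 0) (v 1) t) = d * edge_bubble r t" for t
  proof (rule edge_restriction[OF p r])
    fix j assume "j \<le> r"
    then show "p (edge_pt (v 0) (v 1) (2 * real j / real r - 1)) = d * edge_bubble r (2 * real j / real r - 1)"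
      using zero[of "v 0" "v 1" j] sup[of j] by (simp add: Let_def)
  qed
  show c: "c = 0"
    by (rule opposite_edges[OF p r, of "n 0" "v 0" "\<beta> 0" "v 1" "v 3" "v 2" "n 2" "\<beta> 2" "n 1" "\<beta> 1"])
       (rule edge_values E12 E03)+
  show d: "d = 0"
    by (rule opposite_edges[OF p r, of "n 3" "v 0" "\<beta> 3" "v 3" "v 1" "v 2" "n 1" "\<beta> 1" "n 2" "\<beta> 2"])
       (rule edge_values E32 E01)+
  fix i x assume i: "i < 4" and x: "n i \<bullet> x = \<beta> i"
  have ne: "v 0 \<noteq> v 1" "v 1 \<noteq> v 2" "v 3 \<noteq> v 2" "v 0 \<noteq> v 3"
    using edge_values(2,5,6,7,9,11,12,14,10,8) edge_values(3,4) by auto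
  from i consider "i = 0" | "i = 1" | "i = 2" | "i = 3" by linarith
  then show "p x = 0"
  proof cases
    case 1
    then obtain t where "x = edge_pt (v 0) (v 1) t" using line_through_edge[OF i x ne(1)] edge_values by metis
    then show ?thesis using E01 d by simp
  next
    case 2
    then obtain t where "x = edge_pt (v 1) (v 2) t" using line_through_edge[OF i x ne(2)] edge_values by metis
    then show ?thesis using E12 c by simp
  next
    case 3
    then obtain t where "x = edge_pt (v 3) (v 2) t" using line_through_edge[OF i x ne(3)] edge_values by metis
    then show ?thesis using E32 d by simp
  next
    case 4
    then obtain t where "x = edge_pt (v 0) (v 3) t" using line_through_edge[OF i x ne(4)] edge_values by metis
    then show ?thesis using E03 c by simp
  qed
qed

text \<open>The degree bound \<open>r - 3\<close> is strict; for \<open>r\<close> less than 4 it forces \<open>q = 0\<close>.\<close>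

lemma factor_edges:
  assumes p: "deg_less (Suc r) p" and zero: "\<And>i x. i < 4 \<Longrightarrow> n i \<bullet> x = \<beta> i \<Longrightarrow> p x = 0"
  obtains q where "deg_less (r - 3) q" "\<And>x. p x = (\<Prod>i<4. \<beta> i - n i \<bullet> x) * q x"
proof -
  have "\<exists>y. n j \<bullet> y = \<beta> j \<and> n i \<bullet> y \<noteq> \<beta> i" if "i < j" "j < 4" for i j
  proof -
    consider "i = 0 \<and> (j = 1 \<or> j = 2)" | "j = 3 \<and> (i = 0 \<or> i = 1) \<or> i = 1 \<and> j = 2" | "i = 2 \<and> j = 3"
    proof -
      have "i = 0 \<or> i = 1 \<or> i = 2" "j = 1 \<or> j = 2 \<or> j = 3" using \<open>i < j\<close> \<open>j < 4\<close> by linarith+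
      with \<open>i < j\<close> show ?thesis using that by auto
    qed
    then show ?thesis
    proof cases
      case 1
      then show ?thesis using edge_values by (intro exI[of _ "v 2"]) auto
    next
      case 2
      then show ?thesis using edge_values by (intro exI[of _ "v 3"]) auto
    next
      case 3
      then show ?thesis using edge_values by (intro exI[of _ "v 0"]) auto
    qed
  qed
  then have "\<exists>q. deg_less (Suc r - 4) q \<and> (\<forall>x. p x = (\<Prod>i<4. \<beta> i - n i \<bullet> x) * q x)"
    by (intro deg_less_factor_lines[OF p] normal_nonzero zero) auto
  then show ?thesis using that by auto
qed

text \<open>From an interior point one can move a little in the direction of the outer normal without leaving \<open>E\<close>.\<close>

lemma support_pos_interior:
  assumes "x \<in> interior E" "i < 4"
  shows "n i \<bullet> x < \<beta> i"
proof -
  obtain e where e: "e > 0" "cball x e \<subseteq> E" using assms(1) by (auto simp: mem_interior_cball)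
  define y where "y = x + (e / norm (n i)) *\<^sub>R n i"
  have nn: "norm (n i) > 0" using normal_nonzero[OF assms(2)] by simp
  then have "y \<in> cball x e" using e by (simp add: y_def dist_norm)
  then have "n i \<bullet> y \<le> \<beta> i" using e supp[OF assms(2)] by blast
  moreover have "n i \<bullet> y = n i \<bullet> x + e * norm (n i)"
    using nn by (simp add: y_def inner_simps dot_square_norm power2_eq_square)
  ultimately show ?thesis using e nn by (smt (verit) mult_pos_pos)
qed

lemma boundary_unisolvence:
  assumes p: "deg_less (Suc r) p" and r: "2 \<le> r"
    and zero: "\<And>x. x \<in> nodal_points r v a b e \<Longrightarrow> x \<in> E \<Longrightarrow> p x + c * suppl1 r x + d * suppl2 r x = 0"
  shows "c = 0" "d = 0" "\<And>i x. i < 4 \<Longrightarrow> n i \<bullet> x = \<beta> i \<Longrightarrow> p x = 0"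
proof -
  have V: "v i \<in> nodal_points r v a b e" if "i < 4" for i
    using that by (auto simp: nodal_points_def)
  have "edge_nodes r (v i) (v (Suc i mod 4)) \<subseteq> nodal_points r v a b e" if "i < 4" for i
    using that unfolding nodal_points_def by blast
  note N' = this
  have s: "Suc 0 mod 4 = (1::nat)" "Suc 1 mod 4 = (2::nat)" "Suc 2 mod 4 = (3::nat)" "Suc 3 mod 4 = (0::nat)"
    by simp_all
  have N: "edge_nodes r (v 0) (v 1) \<subseteq> nodal_points r v a b e" "edge_nodes r (v 1) (v 2) \<subseteq> nodal_points r v a b e"
    "edge_nodes r (v 2) (v 3) \<subseteq> nodal_points r v a b e" "edge_nodes r (v 3) (v 0) \<subseteq> nodal_points r v a b e"
    using N'[of 0, unfolded s] N'[of 1, unfolded s] N'[of 2, unfolded s] N'[of 3, unfolded s] by simp_all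
  have *: "(let x = edge_pt A B (2 * real j / real r - 1) in p x + c * suppl1 r x + d * suppl2 r x) = 0"
    if AB: "(A, B) \<in> {(v 1, v 2), (v 0, v 3), (v 3, v 2), (v 0, v 1)}" and j: "j \<le> r" for A B j
  proof -
    have "{A, B} \<union> edge_nodes r A B \<subseteq> nodal_points r v a b e"
      using AB N V edge_nodes_commute[of r "v 3" "v 2"] edge_nodes_commute[of r "v 0" "v 3"] by auto
    then have "edge_pt A B (2 * real j / real r - 1) \<in> nodal_points r v a b e"
      using edge_pt_nodes[OF r j, of A B] by blast
    moreover have "-1 \<le> 2 * real j / real r - 1" "2 * real j / real r - 1 \<le> 1"
      using j r by (auto simp: field_simps)
    then have "edge_pt A B (2 * real j / real r - 1) \<in> E" using AB edge_pt_in by auto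
    ultimately show ?thesis using zero by (simp add: Let_def)
  qed
  show "c = 0" "d = 0" "\<And>i x. i < 4 \<Longrightarrow> n i \<bullet> x = \<beta> i \<Longrightarrow> p x = 0"
    using edge_nodes_vanish[OF p r *] by blast+
qed

lemma unisolvence:
  assumes p: "deg_less (Suc r) p" and r: "2 \<le> r"
    and tri: "4 \<le> r \<Longrightarrow> \<not> collinear {a, b, e} \<and> convex hull {a, b, e} \<subseteq> interior E"
    and zero: "\<And>x. x \<in> nodal_points r v a b e \<Longrightarrow> x \<in> E \<Longrightarrow> p x + c * suppl1 r x + d * suppl2 r x = 0"
  shows "p x = 0"
proof -
  have bd: "c = 0" "d = 0" "\<And>i x. i < 4 \<Longrightarrow> n i \<bullet> x = \<beta> i \<Longrightarrow> p x = 0"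
    using boundary_unisolvence[OF p r zero] by blast+
  obtain q where q: "deg_less (r - 3) q" and pq: "\<And>x. p x = (\<Prod>i<4. \<beta> i - n i \<bullet> x) * q x"
    by (rule factor_edges[OF p bd(3)]) (assumption | rule that)+
  have "q x = 0"
  proof (cases "4 \<le> r")
    case False
    then have "r - 3 = 0" by simp
    then show ?thesis using q deg_less_0_imp_zero[of q x] by simp
  next
    case True
    have rr: "r - 3 = Suc (r - 4)" using True by simp
    show ?thesis
    proof (rule lagrange_nodes_unisolvent)
      show "deg_less (Suc (r - 4)) q" using q unfolding rr .
      show "\<not> collinear {a, b, e}" using tri True by blast
      fix x assume x: "x \<in> lagrange_nodes (r - 4) a b e"
      then have int: "x \<in> interior E" using lagrange_nodes_subset_hull tri True by blast
      have "x \<in> nodal_points r v a b e" using x True by (simp add: nodal_points_def)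
      then have "p x = 0" using zero[of x] int interior_subset bd(1,2) by auto
      moreover have "\<beta> i - n i \<bullet> x \<noteq> 0" if "i < 4" for i
        using support_pos_interior[OF int that] by simp
      then have "(\<Prod>i<4. \<beta> i - n i \<bullet> x) \<noteq> 0" by simp
      ultimately show "q x = 0" using pq by simp
    qed
  qed
  then show ?thesis using pq by simp
qed

section \<open>Directness and dimensions\<close>

text \<open>The triangle of three vertices contains a lattice of any order, which determines the polynomial.\<close>

lemma polynomial_vanishing_on_E:
  assumes p: "deg_less m p" and zero: "\<And>x. x \<in> E \<Longrightarrow> p x = 0"
  shows "p x = 0"
proof (rule deg_less_lattice_unisolvent[OF p])
  let ?e = "1 / real (Suc m)"
  show "n 0 \<bullet> (?e *\<^sub>R (v 1 - v 0)) = 0" "n 0 \<bullet> (?e *\<^sub>R (v 3 - v 0)) \<noteq> 0"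
    using edge_values by (simp_all add: inner_simps)
  show "?e *\<^sub>R (v 1 - v 0) \<noteq> 0" using edge_values by auto
  fix i j assume ij: "i + j < m"
  define a b where "a = real i / real (Suc m)" and "b = real j / real (Suc m)"
  have "v 0 + real i *\<^sub>R ?e *\<^sub>R (v 1 - v 0) + real j *\<^sub>R ?e *\<^sub>R (v 3 - v 0) =
      v 0 + a *\<^sub>R (v 1 - v 0) + b *\<^sub>R (v 3 - v 0)"
    by (simp add: a_def b_def)
  also have "\<dots> = (1 - a - b) *\<^sub>R v 0 + a *\<^sub>R v 1 + b *\<^sub>R v 3"
    by (simp add: algebra_simps)
  also have "\<dots> \<in> E"
  proof -
    have "0 \<le> a" "0 \<le> b" by (simp_all add: a_def b_def)
    moreover have "a + b \<le> 1"
      using ij by (simp add: a_def b_def flip: add_divide_distrib of_nat_add)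
    ultimately have "(1 - a - b) *\<^sub>R v 0 + a *\<^sub>R v 1 + b *\<^sub>R v 3 \<in> convex hull {v 0, v 1, v 3}"
      unfolding convex_hull_3 by force
    moreover have "convex hull {v 0, v 1, v 3} \<subseteq> E" using vertex by (intro hull_minimal convex) auto
    ultimately show ?thesis by blast
  qed
  finally show "p (v 0 + real i *\<^sub>R ?e *\<^sub>R (v 1 - v 0) + real j *\<^sub>R ?e *\<^sub>R (v 3 - v 0)) = 0"
    by (rule zero)
qed

lemma monomials_independent:
  assumes "(\<Sum>k\<in>exponents r. fun_scale (c k) (monomial E k)) = 0" "k \<in> exponents r"
  shows "c k = 0"
proof (rule coefficients_zero[OF _ assms(2)])
  fix x :: "real^2"
  have "(\<Sum>i\<le>r. \<Sum>j\<le>r - i. c (i, j) * (y$1)^i * (y$2)^j) = 0" if "y \<in> E" for y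
    using fun_cong[OF assms(1)[unfolded sum_monomials], of y] that by (simp add: on_set_def)
  then show "(\<Sum>i\<le>r. \<Sum>j\<le>r - i. c (i, j) * (x$1)^i * (x$2)^j) = 0"
    by (rule polynomial_vanishing_on_E[OF deg_less_monomial_sum[of r "curry c", simplified]])
qed

lemma inj_on_monomial: "inj_on (monomial E) (exponents r)"
proof (rule inj_onI, rule ccontr)
  fix k l assume k: "k \<in> exponents r" and l: "l \<in> exponents r" and eq: "monomial E k = monomial E l" and ne: "k \<noteq> l"
  define c where "c m = (if m = k then 1 else if m = l then - 1 else 0 :: real)" for m
  have "(\<Sum>m\<in>exponents r. fun_scale (c m) (monomial E m)) = (\<Sum>m\<in>{k, l}. fun_scale (c m) (monomial E m))"
    by (rule sum.mono_neutral_right) (auto simp: finite_exponents k l c_def)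
  also have "\<dots> = 0" using ne eq by (simp add: c_def)
  finally have "c k = 0" using k by (rule monomials_independent)
  then show False by (simp add: c_def)
qed

lemma independent_monomials: "fun_space.independent (monomial E ` exponents r)"
proof (rule fun_space.independent_if_scalars_zero)
  show "finite (monomial E ` exponents r)" by (simp add: finite_exponents)
  fix f p assume sum: "(\<Sum>p\<in>monomial E ` exponents r. fun_scale (f p) p) = 0" and p: "p \<in> monomial E ` exponents r"
  then show "f p = 0"
    using monomials_independent[where r = r and c = "\<lambda>k. f (monomial E k)"] by (auto simp: sum.reindex[OF inj_on_monomial])
qed

lemma dim_poly_space: "2 * fun_space.dim (poly_space r E) = (r + 1) * (r + 2)"
proof -
  have "fun_space.dim (poly_space r E) = card (monomial E ` exponents r)"
    unfolding poly_space_eq fun_space.dim_span by (rule fun_space.dim_eq_card_independent[OF independent_monomials])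
  then show ?thesis by (simp add: card_image[OF inj_on_monomial] card_exponents)
qed

lemma supplements_eq: "supplements r E v = {suppl1 r, suppl2 r}"
  by (simp add: supplements_def suppl1_def suppl2_def)

lemma span_supplements:
  assumes "s \<in> fun_space.span (supplements r E v)"
  obtains c d where "s = fun_scale c (suppl1 r) + fun_scale d (suppl2 r)"
proof -
  obtain c where c: "s - fun_scale c (suppl1 r) \<in> fun_space.span {suppl2 r}"
    using assms unfolding supplements_eq fun_space.span_insert[of "suppl1 r"] by blast
  then obtain d where "s - fun_scale c (suppl1 r) = fun_scale d (suppl2 r)"
    unfolding fun_space.span_singleton by blast
  then have "s = fun_scale c (suppl1 r) + fun_scale d (suppl2 r)" by (metis add.commute diff_add_cancel)
  then show ?thesis by (rule that)
qed

lemma poly_space_cases: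
  assumes "p \<in> poly_space r E"
  obtains P where "deg_less (Suc r) P" "p = on_set E P"
  using assms deg_less_monomial_sum by (auto simp: poly_space_def)

text \<open>A relation on all of \<open>E\<close> holds in particular at the nodes on the boundary, which already force both
  coefficients to vanish.\<close>

lemma supplements_independent:
  assumes p: "p \<in> poly_space r E" and r: "2 \<le> r" and sum: "p + fun_scale c (suppl1 r) + fun_scale d (suppl2 r) = 0"
  shows "c = 0" "d = 0"
proof -
  obtain P where P: "deg_less (Suc r) P" "p = on_set E P" using poly_space_cases[OF p] by blast
  have "P x + c * suppl1 r x + d * suppl2 r x = 0" if "x \<in> E" for x
    using fun_cong[OF sum, of x] that by (simp add: P(2) on_set_def fun_scale_def)
  then show "c = 0" "d = 0" using boundary_unisolvence[OF P(1) r] by blast+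
qed

lemma direct_sum:
  assumes r: "2 \<le> r"
  shows "poly_space r E \<inter> fun_space.span (supplements r E v) = {0}"
proof -
  have "s = 0" if sP: "s \<in> poly_space r E" and sS: "s \<in> fun_space.span (supplements r E v)" for s
  proof -
    obtain c d where s: "s = fun_scale c (suppl1 r) + fun_scale d (suppl2 r)" using span_supplements[OF sS] by blast
    have "s + fun_scale (- c) (suppl1 r) + fun_scale (- d) (suppl2 r) = 0"
      by (simp add: s fun_space.scale_minus_left)
    then have "c = 0" "d = 0" using supplements_independent[OF sP r, of "- c" "- d"] by simp_all
    then show ?thesis by (simp add: s)
  qed
  moreover have "0 \<in> poly_space r E" "0 \<in> fun_space.span (supplements r E v)"
    by (simp_all add: poly_space_eq fun_space.span_zero)
  ultimately show ?thesis by blast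
qed

lemma dim_DS_map:
  assumes r: "2 \<le> r"
  shows "fun_space.dim (DS_map r E v) = fun_space.dim (poly_space r E) + 2"
proof -
  let ?B = "monomial E ` exponents r"
  have s2: "suppl2 r \<notin> fun_space.span ?B"
  proof
    assume "suppl2 r \<in> fun_space.span ?B"
    then show False using supplements_independent(2)[OF _ r, of "suppl2 r" 0 "- 1"]
      by (simp add: poly_space_eq fun_space.scale_minus_left)
  qed
  have s1: "suppl1 r \<notin> fun_space.span (insert (suppl2 r) ?B)"
  proof
    assume "suppl1 r \<in> fun_space.span (insert (suppl2 r) ?B)"
    then obtain k where "suppl1 r - fun_scale k (suppl2 r) \<in> poly_space r E"
      unfolding fun_space.span_insert poly_space_eq by blast
    then show False using supplements_independent(1)[OF _ r, of "suppl1 r - fun_scale k (suppl2 r)" "- 1" k]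
      by (simp add: fun_space.scale_minus_left)
  qed
  have ind: "fun_space.independent (insert (suppl1 r) (insert (suppl2 r) ?B))"
    using s1 s2 independent_monomials by (simp add: fun_space.independent_insert fun_space.span_base)
  have "DS_map r E v = fun_space.span (insert (suppl1 r) (insert (suppl2 r) ?B))"
  proof -
    have "insert (suppl1 r) (insert (suppl2 r) ?B) = ?B \<union> supplements r E v"
      by (auto simp: supplements_eq)
    then show ?thesis by (simp add: fun_space.span_Un DS_map_def poly_space_eq)
  qed
  then have "fun_space.dim (DS_map r E v) = card (insert (suppl1 r) (insert (suppl2 r) ?B))"
    using fun_space.dim_eq_card_independent[OF ind] by simp
  also have "\<dots> = card ?B + 2"
  proof -
    have "suppl2 r \<notin> ?B" by (rule contrapos_nn[OF s2 fun_space.span_base])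
    moreover have "suppl1 r \<notin> insert (suppl2 r) ?B" by (rule contrapos_nn[OF s1 fun_space.span_base])
    ultimately show ?thesis using finite_exponents[of r] by simp
  qed
  also have "card ?B = fun_space.dim (poly_space r E)"
    unfolding poly_space_eq fun_space.dim_span by (rule fun_space.dim_eq_card_independent[OF independent_monomials, symmetric])
  finally show ?thesis .
qed

lemma node_count_eq:
  assumes r: "2 \<le> r"
  shows "node_count r = fun_space.dim (poly_space r E) + 2"
proof -
  have "2 * node_count r = (r + 1) * (r + 2) + 4"
  proof (cases "r = 2")
    case False
    then obtain s where s: "r = s + 3" using r le_Suc_ex[of 3 r] by (auto simp: add.commute)
    have "even ((s + 1) * s)" by simp
    then have "2 * ((s + 1) * s div 2) = (s + 1) * s" by (rule dvd_mult_div_cancel)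
    then show ?thesis by (simp add: node_count_def s algebra_simps)
  qed (simp add: node_count_def)
  then show ?thesis using dim_poly_space[of r] by linarith
qed

lemma DS_map_unisolvent:
  assumes r: "2 \<le> r"
    and tri: "4 \<le> r \<Longrightarrow> \<not> collinear {a, b, c} \<and> convex hull {a, b, c} \<subseteq> interior E"
    and \<phi>: "\<phi> \<in> DS_map r E v" and zero: "\<And>x. x \<in> nodal_points r v a b c \<Longrightarrow> \<phi> x = 0"
  shows "\<phi> = 0"
proof -
  obtain p s where p: "p \<in> poly_space r E" and s: "s \<in> fun_space.span (supplements r E v)" and \<phi>: "\<phi> = p + s"
    using \<phi> by (auto simp: DS_map_def)
  obtain P where P: "deg_less (Suc r) P" "p = on_set E P" using poly_space_cases[OF p] by blast
  obtain \<kappa> \<mu> where sup: "s = fun_scale \<kappa> (suppl1 r) + fun_scale \<mu> (suppl2 r)" using span_supplements[OF s] by blast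
  have Z: "P x + \<kappa> * suppl1 r x + \<mu> * suppl2 r x = 0" if "x \<in> nodal_points r v a b c" "x \<in> E" for x
    using zero[OF that(1)] that(2) by (simp add: \<phi> sup P(2) on_set_def fun_scale_def)
  have "\<kappa> = 0" "\<mu> = 0" using boundary_unisolvence[OF P(1) r Z] by blast+
  moreover have "P x = 0" for x using unisolvence[OF P(1) r tri Z] by blast
  then have "p = 0" by (simp add: P(2) on_set_def fun_eq_iff)
  ultimately show ?thesis by (simp add: \<phi> sup)
qed

end

text \<open>Faces of a polyhedron are exposed, which provides the supporting lines. A vertex off the edge is off
  the line, since an extreme point on a segment of \<open>E\<close> is one of its ends.\<close>

lemma supported_quadrilateral_exists:
  assumes quad: "convex_quadrilateral E" and cyc: "vertex_cycle E v"
  obtains n \<beta> where "supported_quadrilateral E v n \<beta>"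
proof -
  have poly: "polytope E" using quad by (simp add: convex_quadrilateral_def)
  have bij: "bij_betw v {..<4} {x. x extreme_point_of E}"
    and edge: "\<And>i. i < 4 \<Longrightarrow> closed_segment (v i) (v (Suc i mod 4)) face_of E"
    using cyc by (auto simp: vertex_cycle_def edge_of_def)
  have ext: "v i extreme_point_of E" if "i < 4" for i
    using bij_betwE[OF bij] that by auto
  have "\<exists>n \<beta>. E \<subseteq> {x. n \<bullet> x \<le> \<beta>} \<and> closed_segment (v i) (v (Suc i mod 4)) = E \<inter> {x. n \<bullet> x = \<beta>}" if "i < 4" for i
    using edge[OF that] exposed_face_of_polyhedron[OF polytope_imp_polyhedron[OF poly]]
    by (auto simp: exposed_face_of_def)
  then have "\<exists>n \<beta>. \<forall>i<4. E \<subseteq> {x. n i \<bullet> x \<le> \<beta> i} \<and> closed_segment (v i) (v (Suc i mod 4)) = E \<inter> {x. n i \<bullet> x = \<beta> i}"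
    by metis
  then obtain n \<beta> where supp: "\<And>i. i < 4 \<Longrightarrow> E \<subseteq> {x. n i \<bullet> x \<le> \<beta> i}"
    and seg: "\<And>i. i < 4 \<Longrightarrow> closed_segment (v i) (v (Suc i mod 4)) = E \<inter> {x. n i \<bullet> x = \<beta> i}"
    by blast
  have "supported_quadrilateral E v n \<beta>"
  proof
    show "convex E" using poly by (rule polytope_imp_convex)
    show V: "v i \<in> E" if "i < 4" for i using ext[OF that] by (simp add: extreme_point_of_def)
    show "n i \<bullet> x \<le> \<beta> i" if "i < 4" "x \<in> E" for i x using supp[OF that(1)] that(2) by blast
    show "n i \<bullet> v i = \<beta> i" "n i \<bullet> v (Suc i mod 4) = \<beta> i" if "i < 4" for i
    proof -
      have "v i \<in> closed_segment (v i) (v (Suc i mod 4))" "v (Suc i mod 4) \<in> closed_segment (v i) (v (Suc i mod 4))"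
        by simp_all
      then show "n i \<bullet> v i = \<beta> i" "n i \<bullet> v (Suc i mod 4) = \<beta> i" using seg[OF that] by blast+
    qed
    show "n i \<bullet> v j < \<beta> i" if "i < 4" "j < 4" "j \<noteq> i" "j \<noteq> Suc i mod 4" for i j
    proof (rule ccontr)
      assume "\<not> n i \<bullet> v j < \<beta> i"
      then have "v j \<in> closed_segment (v i) (v (Suc i mod 4))"
        using seg[OF that(1)] supp[OF that(1)] V[OF that(2)] by fastforce
      moreover have "v j \<notin> open_segment (v i) (v (Suc i mod 4))"
        using ext[OF that(2)] V[OF that(1)] V[of "Suc i mod 4"] by (simp add: extreme_point_of_def)
      ultimately have "v j = v i \<or> v j = v (Suc i mod 4)" by (auto simp: open_segment_def)
      moreover have "inj_on v {..<4}" using bij by (rule bij_betw_imp_inj_on)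
      ultimately show False using that by (auto dest: inj_onD)
    qed
  qed
  then show ?thesis by (rule that)
qed

theorem mainTheorem2:
  fixes E :: "(real^2) set" and v :: "nat \<Rightarrow> real^2" and r :: nat and a b c :: "real^2"
  assumes "convex_quadrilateral E" and "vertex_cycle E v" and "2 \<le> r"
    and "4 \<le> r \<Longrightarrow> \<not> collinear {a, b, c} \<and> convex hull {a, b, c} \<subseteq> interior E"
  shows "poly_space r E \<inter> fun_space.span (supplements r E v) = {0} \<and>
    fun_space.dim (DS_map r E v) = node_count r \<and>
    node_count r = fun_space.dim (poly_space r E) + 2 \<and>
    (\<forall>\<phi>\<in>DS_map r E v. (\<forall>x\<in>nodal_points r v a b c. \<phi> x = 0) \<longrightarrow> \<phi> = 0)"
proof -
  obtain n \<beta> where "supported_quadrilateral E v n \<beta>"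
    using supported_quadrilateral_exists[OF assms(1,2)] by blast
  then interpret supported_quadrilateral E v n \<beta> .
  show ?thesis
    using direct_sum[OF assms(3)] dim_DS_map[OF assms(3)] node_count_eq[OF assms(3)]
      DS_map_unisolvent[OF assms(3,4)] by auto
qed

end
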